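(* Let $G$ be a connected, locally finite, infinite graph such that for every vertex $u\in V(G)$ and every integer $r\ge 1$ the ball $G_r(u)$ is Hamiltonian. Then $G$ has a Hamiltonian curve.
   Context: Graphs have no loops or multiple edges. A graph is locally finite if every vertex has finite degree. For a vertex $u$ of a graph $G$ and an integer $r\ge 0$, $M_r(u)$ is the set of vertices at distance at most $r$ from $u$ in $G$, and the ball $G_r(u)$ of radius $r$ centered at $u$ is the subgraph of $G$ induced by $M_r(u)$. A finite graph is Hamiltonian if it has a cycle (of length at least $3$) containing all its vertices. A ray is a one-way infinite path. Two rays of $G$ are equivalent if for every finite $S\subset V(G)$ both have a tail in the same component of $G-S$; the equivalence classes are the ends of $G$. $|G|$ denotes the Freudenthal compactification of $G$: the topological space obtained from $G$, viewed as a 1-complex, by adding the ends of $G$ as additional points, with the standard topology (every ray converges to the end containing it). A closed curve in $|G|$ is the image of a continuous map from the unit circle $S^1$ to $|G|$. A Hamiltonian curve of $G$ is a closed curve in $|G|$ that meets every vertex of $G$ exactly once (i.e. each vertex is the image of exactly one point of $S^1$). *)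

theory Defs
  imports "HOL-Analysis.Analysis"
begin

section \<open>Graphs\<close>

datatype 'a graph = Graph (verts: "'a set") (edges: "'a set set")

definition simple_graph :: "'a graph \<Rightarrow> bool" where
  "simple_graph G \<longleftrightarrow> (\<forall>e\<in>edges G. e \<subseteq> verts G \<and> card e = 2)"

definition locally_finite_graph :: "'a graph \<Rightarrow> bool" where
  "locally_finite_graph G \<longleftrightarrow> (\<forall>v\<in>verts G. finite {e \<in> edges G. v \<in> e})"

definition induced :: "'a graph \<Rightarrow> 'a set \<Rightarrow> 'a graph" where
  "induced G W = Graph (verts G \<inter> W) {e \<in> edges G. e \<subseteq> W}"

definition delete_verts :: "'a graph \<Rightarrow> 'a set \<Rightarrow> 'a graph" where
  "delete_verts G S = induced G (verts G - S)"

definition walk :: "'a graph \<Rightarrow> 'a \<Rightarrow> 'a list \<Rightarrow> 'a \<Rightarrow> bool" where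
  "walk G u p v \<longleftrightarrow> p \<noteq> [] \<and> hd p = u \<and> last p = v \<and> set p \<subseteq> verts G \<and>
     successively (\<lambda>x y. {x, y} \<in> edges G) p"

definition connected_graph :: "'a graph \<Rightarrow> bool" where
  "connected_graph G \<longleftrightarrow> verts G \<noteq> {} \<and> (\<forall>u\<in>verts G. \<forall>v\<in>verts G. \<exists>p. walk G u p v)"

text \<open>Components are represented by their vertex sets.\<close>

definition graph_components :: "'a graph \<Rightarrow> 'a set set" where
  "graph_components G = {{v. \<exists>p. walk G u p v} | u. u \<in> verts G}"

text \<open>The distance is \<open>\<infinity>\<close> if there is no walk between the two vertices.\<close>

definition graph_dist :: "'a graph \<Rightarrow> 'a \<Rightarrow> 'a \<Rightarrow> enat" where
  "graph_dist G u v = (INF p\<in>{p. walk G u p v}. enat (length p - 1))"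

definition ball_verts :: "'a graph \<Rightarrow> 'a \<Rightarrow> nat \<Rightarrow> 'a set" where
  "ball_verts G u r = {v \<in> verts G. graph_dist G u v \<le> enat r}"

definition graph_ball :: "'a graph \<Rightarrow> 'a \<Rightarrow> nat \<Rightarrow> 'a graph" where
  "graph_ball G u r = induced G (ball_verts G u r)"

definition graph_cycle :: "'a graph \<Rightarrow> 'a list \<Rightarrow> bool" where
  "graph_cycle G c \<longleftrightarrow> length c \<ge> 3 \<and> distinct c \<and> set c \<subseteq> verts G \<and>
     successively (\<lambda>x y. {x, y} \<in> edges G) c \<and> {last c, hd c} \<in> edges G"

definition hamiltonian :: "'a graph \<Rightarrow> bool" where
  "hamiltonian G \<longleftrightarrow> finite (verts G) \<and> (\<exists>c. graph_cycle G c \<and> set c = verts G)"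


section \<open>Ends\<close>

text \<open>A ray is given by the sequence of its vertices, in order from its first vertex.\<close>

definition rays :: "'a graph \<Rightarrow> (nat \<Rightarrow> 'a) set" where
  "rays G = {r. inj r \<and> range r \<subseteq> verts G \<and> (\<forall>n. {r n, r (Suc n)} \<in> edges G)}"

definition has_tail_in :: "(nat \<Rightarrow> 'a) \<Rightarrow> 'a set \<Rightarrow> bool" where
  "has_tail_in r C \<longleftrightarrow> (\<exists>n. \<forall>m\<ge>n. r m \<in> C)"

definition ray_equiv :: "'a graph \<Rightarrow> ((nat \<Rightarrow> 'a) \<times> (nat \<Rightarrow> 'a)) set" where
  "ray_equiv G = {(r, s). r \<in> rays G \<and> s \<in> rays G \<and>
     (\<forall>S. finite S \<and> S \<subseteq> verts G \<longrightarrow>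
        (\<exists>C\<in>graph_components (delete_verts G S). has_tail_in r C \<and> has_tail_in s C))}"

definition graph_ends :: "'a graph \<Rightarrow> (nat \<Rightarrow> 'a) set set" where
  "graph_ends G = rays G // ray_equiv G"

definition ends_in :: "'a graph \<Rightarrow> 'a set \<Rightarrow> (nat \<Rightarrow> 'a) set set" where
  "ends_in G C = {\<omega> \<in> graph_ends G. \<exists>r\<in>\<omega>. has_tail_in r C}"


section \<open>The Freudenthal compactification\<close>

text \<open>
  The points of the 1-complex are encoded by their barycentric coordinates.
  The point \<open>edge_point u v t\<close> lies on the edge \<open>uv\<close> at distance \<open>t\<close> from \<open>u\<close>; in particular
  \<open>edge_point u v t = edge_point v u (1 - t)\<close> for \<open>u \<noteq> v\<close>.
\<close>

definition vertex_point :: "'a \<Rightarrow> 'a \<Rightarrow> real" where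
  "vertex_point v = (\<lambda>w. if w = v then 1 else 0)"

definition edge_point :: "'a \<Rightarrow> 'a \<Rightarrow> real \<Rightarrow> 'a \<Rightarrow> real" where
  "edge_point u v t = (\<lambda>w. if w = u then 1 - t else if w = v then t else 0)"

definition complex_points :: "'a graph \<Rightarrow> ('a \<Rightarrow> real) set" where
  "complex_points G = vertex_point ` verts G \<union>
     {edge_point u v t | u v t. {u, v} \<in> edges G \<and> t \<in> {0..1}}"

text \<open>The topology of the 1-complex: a set is open iff its trace on every edge is open.\<close>

definition complex_open :: "'a graph \<Rightarrow> ('a \<Rightarrow> real) set \<Rightarrow> bool" where
  "complex_open G W \<longleftrightarrow> W \<subseteq> complex_points G \<and>
     (\<forall>u v. {u, v} \<in> edges G \<longrightarrow>
        openin (top_of_set {0..1}) {t \<in> {0..1}. edge_point u v t \<in> W})"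

datatype 'a fpoint = Pt "'a \<Rightarrow> real" | End "(nat \<Rightarrow> 'a) set"

text \<open>
  The basic open neighbourhood of the ends that live in a component \<open>C\<close> of \<open>G - S\<close>: it consists of
  the component, the ends living in it, and the inner points at distance less than \<open>\<epsilon>\<close> from \<open>C\<close> on
  the edges between \<open>S\<close> and \<open>C\<close>.
\<close>

definition end_nbhd :: "'a graph \<Rightarrow> 'a set \<Rightarrow> 'a set \<Rightarrow> real \<Rightarrow> 'a fpoint set" where
  "end_nbhd G S C \<epsilon> = Pt ` complex_points (induced G C) \<union> End ` ends_in G C \<union>
     {Pt (edge_point v u t) | v u t. v \<in> C \<and> u \<in> S \<and> {v, u} \<in> edges G \<and> 0 < t \<and> t < \<epsilon>}"

definition freudenthal :: "'a graph \<Rightarrow> 'a fpoint topology" where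
  "freudenthal G = topology_generated_by
     ({Pt ` W | W. complex_open G W} \<union>
      {end_nbhd G S C \<epsilon> | S C \<epsilon>. finite S \<and> S \<subseteq> verts G \<and>
         C \<in> graph_components (delete_verts G S) \<and> ends_in G C \<noteq> {} \<and> 0 < \<epsilon> \<and> \<epsilon> \<le> 1})"

definition hamiltonian_curve :: "'a graph \<Rightarrow> 'a fpoint set \<Rightarrow> bool" where
  "hamiltonian_curve G K \<longleftrightarrow>
     (\<exists>\<gamma>. continuous_map (top_of_set (sphere (0::complex) 1)) (freudenthal G) \<gamma> \<and>
          K = \<gamma> ` sphere 0 1 \<and>
          (\<forall>v\<in>verts G. \<exists>!z. z \<in> sphere 0 1 \<and> \<gamma> z = Pt (vertex_point v)))"


section \<open>Well-definedness\<close>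

lemma walk_rev: "walk G u p v \<Longrightarrow> walk G v (rev p) u"
  by (auto simp: walk_def hd_rev last_rev insert_commute)

lemma walk_trans:
  assumes "walk G u p v" "walk G v q w"
  shows "\<exists>r. walk G u r w"
proof -
  obtain q' where q: "q = v # q'"
    using assms(2) by (cases q) (auto simp: walk_def)
  have "walk G u (p @ q') w"
    using assms by (cases q') (auto simp: walk_def q successively_append_iff)
  then show ?thesis ..
qed

lemma walk_ends: "walk G u p v \<Longrightarrow> u \<in> verts G \<and> v \<in> verts G"
  by (metis hd_in_set last_in_set subsetD walk_def)

lemma graph_components_eq:
  assumes "C \<in> graph_components G" "D \<in> graph_components G" "x \<in> C" "x \<in> D"
  shows "C = D"
proof -
  have *: "C = {v. \<exists>p. walk G x p v}"
    if C: "C \<in> graph_components G" "x \<in> C" for C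
  proof -
    obtain u where u: "C = {v. \<exists>p. walk G u p v}"
      using C by (auto simp: graph_components_def)
    then show ?thesis
      using C(2) by (auto; meson walk_rev walk_trans)
  qed
  show ?thesis using *[of C] *[of D] assms by simp
qed

lemma ray_has_tail:
  assumes r: "r \<in> rays G" and S: "finite S"
  shows "\<exists>C\<in>graph_components (delete_verts G S). has_tail_in r C"
proof -
  let ?H = "delete_verts G S"
  have "finite (r -` S)"
    using r S by (auto simp: rays_def intro: finite_vimageI)
  then obtain n where n: "\<And>m. m \<in> r -` S \<Longrightarrow> m < n"
    by (auto simp: finite_nat_set_iff_bounded)
  have V: "r m \<in> verts ?H" if "m \<ge> n" for m
    using r n[of m] that by (force simp: rays_def delete_verts_def induced_def)
  have E: "{r m, r (Suc m)} \<in> edges ?H" if "m \<ge> n" for m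
    using r V[of m] V[of "Suc m"] that by (auto simp: rays_def delete_verts_def induced_def)
  have "\<exists>p. walk ?H (r n) p (r (n + k))" for k
  proof (induction k)
    case 0
    have "walk ?H (r n) [r n] (r n)" using V[of n] by (simp add: walk_def)
    then show ?case by auto
  next
    case (Suc k)
    have "walk ?H (r (n + k)) [r (n + k), r (n + Suc k)] (r (n + Suc k))"
      using V[of "n + k"] V[of "n + Suc k"] E[of "n + k"] by (simp add: walk_def)
    then show ?case using Suc walk_trans by metis
  qed
  then have "has_tail_in r {v. \<exists>p. walk ?H (r n) p v}"
    unfolding has_tail_in_def by (metis le_Suc_ex mem_Collect_eq)
  then show ?thesis
    using V[of n] by (auto simp: graph_components_def)
qed

lemma equiv_ray_equiv: "equiv (rays G) (ray_equiv G)"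
proof (rule equivI)
  show "ray_equiv G \<subseteq> rays G \<times> rays G"
    by (auto simp: ray_equiv_def)
  show "refl_on (rays G) (ray_equiv G)"
    using ray_has_tail by (fastforce simp: refl_on_def ray_equiv_def)
  show "sym (ray_equiv G)"
    unfolding sym_def ray_equiv_def by blast
  show "trans (ray_equiv G)"
  proof (rule transI)
    fix r s t assume rs: "(r, s) \<in> ray_equiv G" and st: "(s, t) \<in> ray_equiv G"
    have "\<exists>C\<in>graph_components (delete_verts G S). has_tail_in r C \<and> has_tail_in t C"
      if S: "finite S" "S \<subseteq> verts G" for S
    proof -
      obtain C where C: "C \<in> graph_components (delete_verts G S)" "has_tail_in r C" "has_tail_in s C"
        using rs S by (auto simp: ray_equiv_def)
      obtain D where D: "D \<in> graph_components (delete_verts G S)" "has_tail_in s D" "has_tail_in t D"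
        using st S by (auto simp: ray_equiv_def)
      obtain m n where "\<forall>k\<ge>m. s k \<in> C" "\<forall>k\<ge>n. s k \<in> D"
        using C D by (auto simp: has_tail_in_def)
      then have "s (max m n) \<in> C" "s (max m n) \<in> D" by auto
      then have "C = D" using graph_components_eq C D by metis
      then show ?thesis using C D by auto
    qed
    then show "(r, t) \<in> ray_equiv G"
      using rs st by (auto simp: ray_equiv_def)
  qed
qed

lemma topspace_freudenthal:
  "topspace (freudenthal G) = Pt ` complex_points G \<union> End ` graph_ends G"
proof -
  have sub: "end_nbhd G S C \<epsilon> \<subseteq> Pt ` complex_points G \<union> End ` graph_ends G" if "\<epsilon> \<le> 1" for S C \<epsilon>
  proof -
    have "complex_points (induced G C) \<subseteq> complex_points G"
      unfolding complex_points_def induced_def by auto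
    moreover have "ends_in G C \<subseteq> graph_ends G"
      by (auto simp: ends_in_def)
    moreover have "edge_point v u t \<in> complex_points G" if "{v, u} \<in> edges G" "0 < t" "t < \<epsilon>" for u v t
    proof -
      have "t \<in> {0..1}" using that \<open>\<epsilon> \<le> 1\<close> by simp
      then show ?thesis using that(1) unfolding complex_points_def by blast
    qed
    ultimately show ?thesis
      unfolding end_nbhd_def by blast
  qed
  have whole: "complex_open G (complex_points G)"
    unfolding complex_open_def
  proof (intro conjI allI impI)
    fix u v assume "{u, v} \<in> edges G"
    then have "{t \<in> {0..1}. edge_point u v t \<in> complex_points G} = {0..1}"
      unfolding complex_points_def by blast
    then show "openin (top_of_set {0..1}) {t \<in> {0..1}. edge_point u v t \<in> complex_points G}"
      by simp
  qed simp
  have "End \<omega> \<in> topspace (freudenthal G)" if \<omega>: "\<omega> \<in> graph_ends G" for \<omega>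
  proof -
    obtain r where r: "r \<in> rays G" "\<omega> = ray_equiv G `` {r}"
      using \<omega> by (auto simp: graph_ends_def elim: quotientE)
    then have "r \<in> \<omega>"
      using equiv_class_self[OF equiv_ray_equiv] by metis
    moreover obtain C where C: "C \<in> graph_components (delete_verts G {})" "has_tail_in r C"
      using ray_has_tail[OF r(1)] by blast
    ultimately have "\<omega> \<in> ends_in G C"
      using \<omega> by (auto simp: ends_in_def)
    then have "End \<omega> \<in> end_nbhd G {} C 1" "ends_in G C \<noteq> {}"
      by (auto simp: end_nbhd_def)
    then show ?thesis
      using C(1) unfolding freudenthal_def topology_generated_by_topspace
      by (intro UnionI[of "end_nbhd G {} C 1"] UnI2 CollectI exI[of _ "{}"] exI[of _ C] exI[of _ 1]) auto
  qed
  moreover have "Pt ` complex_points G \<subseteq> topspace (freudenthal G)"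
    using whole unfolding freudenthal_def topology_generated_by_topspace by blast
  moreover have "topspace (freudenthal G) \<subseteq> Pt ` complex_points G \<union> End ` graph_ends G"
    unfolding freudenthal_def topology_generated_by_topspace
  proof (rule Union_least)
    fix X assume "X \<in> {Pt ` W | W. complex_open G W} \<union>
      {end_nbhd G S C \<epsilon> | S C \<epsilon>. finite S \<and> S \<subseteq> verts G \<and>
         C \<in> graph_components (delete_verts G S) \<and> ends_in G C \<noteq> {} \<and> 0 < \<epsilon> \<and> \<epsilon> \<le> 1}"
    then consider W where "X = Pt ` W" "complex_open G W"
      | S C \<epsilon> where "X = end_nbhd G S C \<epsilon>" "\<epsilon> \<le> 1"
      by (elim UnE CollectE exE conjE) metis+
    then show "X \<subseteq> Pt ` complex_points G \<union> End ` graph_ends G"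
    proof cases
      case 1
      then have "W \<subseteq> complex_points G" by (simp add: complex_open_def)
      then show ?thesis using 1(1) by blast
    next
      case 2
      then show ?thesis using sub by simp
    qed
  qed
  ultimately show ?thesis by blast
qed

end

theory Submission
  imports Defs "HOL-Library.Diagonal_Subsequence"
begin

text \<open>
  Every finite set of vertices lies in a ball, hence on a Hamiltonian cycle of that ball, which is a
  finite cycle of \<open>G\<close>. By a theorem of Kuendgen, Li and Thomassen, a graph in which every finite
  set of vertices lies on a finite cycle has a Hamiltonian curve. The curve is a limit of the cycles.

  Let \<open>c k\<close> be cycles through a fixed vertex \<open>v0\<close> that eventually contain any given vertex. Started
  at \<open>v0\<close>, each of them is a finite linear order. For each of the countably many pairs \<open>v\<close>, \<open>w\<close> it
  matters whether \<open>v\<close> comes before \<open>w\<close> on \<open>c k\<close>, and which neighbours of \<open>v\<close> follow and precede \<open>v\<close>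
  there. These data take finitely many values because \<open>G\<close> is locally finite, so they are all
  eventually constant along a diagonal subsequence (\<open>diagonal_stabilize\<close>). The limit is a linear
  order of all vertices in which every vertex has an immediate successor \<open>nxt v\<close>, adjacent to it,
  where the successor of the last vertex is \<open>v0\<close>. The order also remembers how the cycles wander
  off: if no vertex of a finite set \<open>S\<close> lies between \<open>u\<close> and \<open>v\<close>, then a segment of some \<open>c k\<close> joins
  \<open>u\<close> to \<open>v\<close> in \<open>G - S\<close> (\<open>limit_of_cycles\<close>).

  Summable weights turn the order into pairwise non-overlapping intervals \<open>[L v, R v]\<close> in \<open>[0, 1]\<close>,
  with \<open>R v = L (nxt v)\<close> unless \<open>v\<close> is the last vertex (\<open>vertex_layout_of_cycles\<close>). The curve runs
  along the edge from \<open>v\<close> to \<open>nxt v\<close> during \<open>[L v, R v]\<close>. A time \<open>t\<close> in none of these intervals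
  determines, for every finite \<open>S\<close>, a gap between consecutive elements of \<open>S\<close>. There are vertices in
  this gap, and they all lie in a single component of \<open>G - S\<close>. These components are compatible for
  different \<open>S\<close>, so by a compactness argument they are the components belonging to one end
  (\<open>end_of_direction\<close>), and the curve is sent to that end. Near \<open>t\<close> the curve meets only vertices of
  the same gap, which is continuity at \<open>t\<close> (\<open>curve_near_uncovered\<close>). Each vertex \<open>v\<close> is met at the
  single time \<open>L v\<close>, whereas several times may be sent to the same end.
\<close>

section \<open>Diagonal subsequences\<close>

text \<open>
  For one index this is the pigeonhole principle; countably many indices need a diagonal
  subsequence. All limits of finite data taken below are instances of it.
\<close>

lemma diagonal_stabilize:
  fixes g :: "'i \<Rightarrow> nat \<Rightarrow> 'b"
  assumes "countable I"
    and fin: "\<And>i. i \<in> I \<Longrightarrow> finite (A i)"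
    and ev: "\<And>i. i \<in> I \<Longrightarrow> \<forall>\<^sub>F k in sequentially. g i k \<in> A i"
  obtains f :: "nat \<Rightarrow> nat"
  where "strict_mono f" "\<And>i. i \<in> I \<Longrightarrow> \<exists>y. \<forall>\<^sub>F k in sequentially. g i (f k) = y"
proof (cases "I = {}")
  case True
  then show ?thesis using that[of id] by (simp add: strict_mono_def)
next
  case False
  define P where "P n s \<longleftrightarrow> (\<exists>y. \<forall>\<^sub>F k in sequentially. g (from_nat_into I n) (s k) = y)"
    for n and s :: "nat \<Rightarrow> nat"
  have sub: "P n (s \<circ> r)" if "strict_mono r" "P n s" for r s :: "nat \<Rightarrow> nat" and n
    using that eventually_subseq unfolding P_def o_def by fastforce
  interpret subseqs P
  proof
    fix n and s :: "nat \<Rightarrow> nat" assume s: "strict_mono s"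
    let ?i = "from_nat_into I n"
    have "?i \<in> I" using False by (rule from_nat_into)
    then have "\<forall>\<^sub>F k in sequentially. g ?i (s k) \<in> A ?i" and A: "finite (A ?i)"
      using ev fin eventually_subseq[OF s] by auto
    then obtain N where N: "\<And>k. k \<ge> N \<Longrightarrow> g ?i (s k) \<in> A ?i"
      by (auto simp: eventually_sequentially)
    then have "finite ((\<lambda>k. g ?i (s k)) ` {N..})"
      by (intro finite_subset[OF _ A]) auto
    then obtain k0 where "infinite {k \<in> {N..}. g ?i (s k) = g ?i (s k0)}"
      using pigeonhole_infinite[of "{N..}" "\<lambda>k. g ?i (s k)"] infinite_Ici by blast
    then obtain r :: "nat \<Rightarrow> nat" where "strict_mono r" "\<And>m. g ?i (s (r m)) = g ?i (s k0)"
      using infinite_enumerate by (metis (mono_tags, lifting) mem_Collect_eq)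
    then show "\<exists>r. strict_mono r \<and> P n (s \<circ> r)"
      unfolding P_def by (intro exI[of _ r]) auto
  qed
  show ?thesis
  proof (rule that[OF subseq_diagseq])
    fix i assume "i \<in> I"
    then obtain n where n: "i = from_nat_into I n"
      using from_nat_into_surj[OF \<open>countable I\<close>] by metis
    have "P n (diagseq \<circ> ((+) (Suc n)))"
      by (rule diagseq_holds[OF sub])
    then obtain y where y: "\<forall>\<^sub>F k in sequentially. g i (diagseq (k + Suc n)) = y"
      unfolding P_def o_def n by (auto simp: add.commute)
    show "\<exists>y. \<forall>\<^sub>F k in sequentially. g i (diagseq k) = y"
      using y eventually_sequentially_seg[of "\<lambda>k. g i (diagseq k) = y"] by blast
  qed
qed

section \<open>Reachability and distance\<close>

definition reach :: "'a graph \<Rightarrow> 'a \<Rightarrow> 'a \<Rightarrow> bool" where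
  "reach H u v \<longleftrightarrow> (\<exists>p. walk H u p v)"

lemma reach_refl: "v \<in> verts H \<Longrightarrow> reach H v v"
  unfolding reach_def by (rule exI[of _ "[v]"]) (simp add: walk_def)

lemma reach_sym: "reach H u v \<Longrightarrow> reach H v u"
  using walk_rev reach_def by metis

lemma reach_trans: "reach H u v \<Longrightarrow> reach H v w \<Longrightarrow> reach H u w"
  using walk_trans reach_def by metis

lemma reach_edge: "{u, v} \<in> edges H \<Longrightarrow> u \<in> verts H \<Longrightarrow> v \<in> verts H \<Longrightarrow> reach H u v"
  unfolding reach_def by (rule exI[of _ "[u, v]"]) (simp add: walk_def)

lemma reach_component:
  assumes "C \<in> graph_components H" "u \<in> C"
  shows "v \<in> C \<longleftrightarrow> reach H u v"
proof -
  obtain w where "C = {v. reach H w v}"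
    using assms(1) by (auto simp: graph_components_def reach_def)
  then show ?thesis
    using assms(2) reach_sym reach_trans by (metis mem_Collect_eq)
qed

lemma component_of: "u \<in> verts H \<Longrightarrow> {v. reach H u v} \<in> graph_components H"
  by (auto simp: graph_components_def reach_def)

lemma component_verts: "C \<in> graph_components H \<Longrightarrow> C \<subseteq> verts H"
  using walk_ends by (fastforce simp: graph_components_def)

lemma verts_delete [simp]: "verts (delete_verts G S) = verts G - S"
  by (auto simp: delete_verts_def induced_def)

lemma edges_delete [simp]:
  "e \<in> edges (delete_verts G S) \<longleftrightarrow> e \<in> edges G \<and> e \<subseteq> verts G - S"
  by (auto simp: delete_verts_def induced_def)

lemma reach_delete_edge:
  "{u, v} \<in> edges G \<Longrightarrow> u \<in> verts G - S \<Longrightarrow> v \<in> verts G - S \<Longrightarrow> reach (delete_verts G S) u v"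
  by (rule reach_edge) auto

lemma reach_delete_mono:
  assumes "reach (delete_verts G S) u v" "T \<subseteq> S"
  shows "reach (delete_verts G T) u v"
proof -
  obtain p where p: "walk (delete_verts G S) u p v"
    using assms reach_def by metis
  have "successively (\<lambda>x y. {x, y} \<in> edges (delete_verts G T)) p"
    by (rule successively_mono[of "\<lambda>x y. {x, y} \<in> edges (delete_verts G S)"])
      (use p assms(2) in \<open>auto simp: walk_def\<close>)
  then have "walk (delete_verts G T) u p v"
    using p assms(2) by (auto simp: walk_def)
  then show ?thesis by (auto simp: reach_def)
qed

lemma edge_verts: "simple_graph G \<Longrightarrow> {u, v} \<in> edges G \<Longrightarrow> u \<in> verts G \<and> v \<in> verts G \<and> u \<noteq> v"
  unfolding simple_graph_def by (metis card_2_iff doubleton_eq_iff insert_subset)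

lemma finite_neighbours:
  assumes "locally_finite_graph G" "v \<in> verts G"
  shows "finite {w. {v, w} \<in> edges G}"
proof -
  have "inj_on (\<lambda>w. {v, w}) {w. {v, w} \<in> edges G}"
    by (auto simp: inj_on_def doubleton_eq_iff)
  moreover have "(\<lambda>w. {v, w}) ` {w. {v, w} \<in> edges G} \<subseteq> {e \<in> edges G. v \<in> e}" by auto
  moreover have "finite {e \<in> edges G. v \<in> e}"
    using assms by (simp add: locally_finite_graph_def)
  ultimately show ?thesis
    by (metis (no_types, lifting) finite_subset finite_imageD)
qed

text \<open>
  A walk on \<open>n + 1\<close> vertices has \<open>n\<close> edges, hence the \<open>Suc n\<close>.
\<close>

lemma graph_dist_le_iff:
  "graph_dist G u v \<le> enat n \<longleftrightarrow> (\<exists>p. walk G u p v \<and> length p \<le> Suc n)"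
proof -
  have "graph_dist G u v \<le> enat n \<longleftrightarrow> graph_dist G u v < enat (Suc n)"
    by (cases "graph_dist G u v") auto
  also have "\<dots> \<longleftrightarrow> (\<exists>p. walk G u p v \<and> length p - 1 < Suc n)"
    unfolding graph_dist_def by (auto simp: INF_less_iff)
  also have "\<dots> \<longleftrightarrow> (\<exists>p. walk G u p v \<and> length p \<le> Suc n)"
    by (auto simp: less_Suc_eq_le)
  finally show ?thesis .
qed

lemma graph_dist_edge:
  assumes "graph_dist G u v \<le> enat n" "{v, w} \<in> edges G" "w \<in> verts G"
  shows "graph_dist G u w \<le> enat (Suc n)"
proof -
  obtain p where p: "walk G u p v" "length p \<le> Suc n"
    using assms(1) graph_dist_le_iff by metis
  then have "walk G u (p @ [w]) w"
    using assms(2,3) by (auto simp: walk_def successively_append_iff)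
  then show ?thesis
    using p(2) graph_dist_le_iff by (metis Suc_le_mono length_append_singleton)
qed

lemma graph_dist_parent:
  assumes "graph_dist G u v \<le> enat (Suc n)" "v \<noteq> u"
  shows "\<exists>w\<in>verts G. graph_dist G u w \<le> enat n \<and> {w, v} \<in> edges G"
proof -
  obtain p where p: "walk G u p v" "length p \<le> Suc (Suc n)"
    using assms(1) graph_dist_le_iff by metis
  obtain q where q: "p = q @ [v]"
    using p(1) unfolding walk_def by (metis append_butlast_last_id)
  have "q \<noteq> []"
    using p(1) assms(2) by (auto simp: q walk_def)
  then have w: "walk G u q (last q)" "{last q, v} \<in> edges G" "last q \<in> verts G"
    using p(1) by (auto simp: q walk_def successively_append_iff)
  then have "graph_dist G u (last q) \<le> enat n"
    using p(2) graph_dist_le_iff q by (metis Suc_le_mono length_append_singleton)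
  then show ?thesis using w by blast
qed

lemma finite_graph_ball:
  assumes "locally_finite_graph G"
  shows "finite {v. graph_dist G u v \<le> enat n}"
proof (induction n)
  case 0
  have "{v. graph_dist G u v \<le> enat 0} \<subseteq> {u}"
  proof
    fix v assume "v \<in> {v. graph_dist G u v \<le> enat 0}"
    then obtain p where p: "walk G u p v" "length p \<le> 1"
      unfolding graph_dist_le_iff mem_Collect_eq by auto
    then show "v \<in> {u}" by (cases p) (auto simp: walk_def)
  qed
  then show ?case by (rule finite_subset) simp
next
  case (Suc n)
  let ?B = "{v. graph_dist G u v \<le> enat n}"
  have "{v. graph_dist G u v \<le> enat (Suc n)} \<subseteq> {u} \<union> (\<Union>w\<in>?B \<inter> verts G. {v. {w, v} \<in> edges G})"
    using graph_dist_parent[of G u _ n] by blast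
  then show ?case
    by (rule finite_subset) (use Suc finite_neighbours[OF assms] in auto)
qed

text \<open>
  In a connected graph all distances from \<open>v0\<close> are finite. The properties below are those that
  make choosing a neighbour one level down a breadth-first search tree with finite levels.
\<close>

lemma level_function:
  assumes G: "simple_graph G" "connected_graph G" "locally_finite_graph G" and v0: "v0 \<in> verts G"
  obtains d :: "'a \<Rightarrow> nat" where
    "d v0 = 0" "\<And>v. v \<in> verts G \<Longrightarrow> d v = 0 \<Longrightarrow> v = v0"
    "\<And>v. v \<in> verts G \<Longrightarrow> v \<noteq> v0 \<Longrightarrow> \<exists>u\<in>verts G. {u, v} \<in> edges G \<and> Suc (d u) = d v"
    "\<And>n. finite {v \<in> verts G. d v \<le> n}"
proof -
  define d where "d v = the_enat (graph_dist G v0 v)" for v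
  have d: "graph_dist G v0 v = enat (d v)" if "v \<in> verts G" for v
  proof -
    obtain p where "walk G v0 p v"
      using G(2) v0 \<open>v \<in> verts G\<close> by (auto simp: connected_graph_def)
    then have "graph_dist G v0 v \<le> enat (length p)"
      by (auto simp: graph_dist_le_iff)
    then show ?thesis by (cases "graph_dist G v0 v") (auto simp: d_def)
  qed
  have "graph_dist G v0 v0 \<le> enat 0"
    using v0 by (auto simp: graph_dist_le_iff walk_def intro!: exI[of _ "[v0]"])
  then have d0: "d v0 = 0"
    using d[OF v0] by simp
  have dz: "v = v0" if v: "v \<in> verts G" "d v = 0" for v
  proof -
    obtain p where p: "walk G v0 p v" "length p \<le> Suc 0"
      using d[OF v(1)] v(2) graph_dist_le_iff[of G v0 v 0] by auto
    then show ?thesis by (cases p) (auto simp: walk_def)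
  qed
  have pos: "d v \<noteq> 0" if "v \<in> verts G" "v \<noteq> v0" for v
    using that dz by blast
  have par: "\<exists>u\<in>verts G. {u, v} \<in> edges G \<and> Suc (d u) = d v" if v: "v \<in> verts G" "v \<noteq> v0" for v
  proof -
    obtain m where m: "d v = Suc m"
      using pos[OF v] not0_implies_Suc by blast
    obtain u where u: "u \<in> verts G" "graph_dist G v0 u \<le> enat m" "{u, v} \<in> edges G"
      using graph_dist_parent[of G v0 v m] d[OF v(1)] m v(2) by auto
    have "graph_dist G v0 v \<le> enat (Suc (d u))"
      using graph_dist_edge[of G v0 u "d u" v] u d[OF u(1)] v(1) by simp
    then have "Suc (d u) = d v"
      using u(2) d[OF u(1)] d[OF v(1)] m by simp
    then show ?thesis using u by blast
  qed
  have "finite {v \<in> verts G. d v \<le> n}" for n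
    by (rule finite_subset[OF _ finite_graph_ball[OF G(3), of v0 n]]) (use d in auto)
  then show thesis
    by (intro that[of d] d0 dz par)
qed

section \<open>Ends from directions\<close>

text \<open>
  A choice of a component of \<open>G - S\<close> for every finite \<open>S\<close>, compatible with inclusion, is called a
  direction, and every direction comes from an end. Here the chosen component is
  given by a nonempty subset \<open>X S\<close> of it, so that \<open>X S \<inter> C \<noteq> {}\<close> says that \<open>C\<close> is the chosen one.

  A ray of the end is found in a breadth-first search tree with levels \<open>d\<close>. Let \<open>B n\<close> be the
  vertices of level at most \<open>n\<close> and \<open>x n\<close> an element of \<open>X (B n)\<close>. The tree paths from the root to
  the vertices \<open>x n\<close> converge along a subsequence, since each level is finite, and their limit is a
  ray \<open>r\<close>. For \<open>j > n\<close> the vertex \<open>r j\<close> is an ancestor of some \<open>x k\<close> with \<open>k \<ge> n\<close>; the tree path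
  between them stays above level \<open>n\<close>, so \<open>r j\<close> lies in the component chosen for \<open>B n\<close>.
\<close>

lemma end_of_direction:
  fixes G :: "'a graph"
  assumes G: "simple_graph G" "connected_graph G" "locally_finite_graph G"
    and sub: "\<And>S. finite S \<Longrightarrow> S \<subseteq> verts G \<Longrightarrow> X S \<noteq> {} \<and> X S \<subseteq> verts G - S"
    and anti: "\<And>S T. finite T \<Longrightarrow> T \<subseteq> verts G \<Longrightarrow> S \<subseteq> T \<Longrightarrow> X T \<subseteq> X S"
    and conn: "\<And>S v w. finite S \<Longrightarrow> S \<subseteq> verts G \<Longrightarrow> v \<in> X S \<Longrightarrow> w \<in> X S \<Longrightarrow>
      reach (delete_verts G S) v w"
  shows "\<exists>\<omega>\<in>graph_ends G. \<forall>S C. finite S \<longrightarrow> S \<subseteq> verts G \<longrightarrow>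
      C \<in> graph_components (delete_verts G S) \<longrightarrow> X S \<inter> C \<noteq> {} \<longrightarrow> \<omega> \<in> ends_in G C"
proof -
  obtain v0 where v0: "v0 \<in> verts G"
    using G(2) by (auto simp: connected_graph_def)
  obtain d :: "'a \<Rightarrow> nat" where d0: "d v0 = 0" "\<And>v. v \<in> verts G \<Longrightarrow> d v = 0 \<Longrightarrow> v = v0"
    and dpar: "\<And>v. v \<in> verts G \<Longrightarrow> v \<noteq> v0 \<Longrightarrow> \<exists>u\<in>verts G. {u, v} \<in> edges G \<and> Suc (d u) = d v"
    and dfin: "\<And>n. finite {v \<in> verts G. d v \<le> n}"
    using level_function[OF G v0] by blast
  define B where "B n = {v \<in> verts G. d v \<le> n}" for n
  have B: "finite (B n)" "B n \<subseteq> verts G" for n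
    using dfin by (auto simp: B_def)
  obtain par where par: "\<And>v. v \<in> verts G \<Longrightarrow> v \<noteq> v0 \<Longrightarrow>
      par v \<in> verts G \<and> {par v, v} \<in> edges G \<and> Suc (d (par v)) = d v"
    using dpar by metis
  \<comment> \<open>The ancestor of \<open>v\<close> in level \<open>j\<close>, provided that \<open>j \<le> d v\<close>.\<close>
  define anc where "anc j v = (par ^^ (d v - j)) v" for j v
  have anc_self: "anc j v = v" if "d v = j" for j v
    using that by (simp add: anc_def)
  have anc_par: "anc j v = anc j (par v)" if "v \<in> verts G" "j < d v" for j v
  proof -
    have "v \<noteq> v0" using that d0 by auto
    then have "d v - j = Suc (d (par v) - j)"
      using par[OF that(1)] that(2) by auto
    then show ?thesis by (simp add: anc_def funpow_swap1)
  qed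
  have anc: "anc j v \<in> verts G \<and> d (anc j v) = j \<and>
      (\<forall>n<j. reach (delete_verts G (B n)) (anc j v) v)"
    if "v \<in> verts G" "j \<le> d v" for j v
    using that
  proof (induction "d v" arbitrary: v)
    case 0
    then show ?case by (auto simp: anc_self)
  next
    case (Suc m)
    have "v \<noteq> v0" using Suc.hyps(2) d0(1) by auto
    then have pv: "par v \<in> verts G" "{par v, v} \<in> edges G" "d (par v) = m"
      using par[OF Suc.prems(1)] Suc.hyps(2) by auto
    show ?case
    proof (cases "j = d v")
      case True
      then show ?thesis using Suc.prems by (auto simp: anc_self B_def intro!: reach_refl)
    next
      case False
      then have j: "j \<le> m" "anc j v = anc j (par v)"
        using Suc anc_par by auto
      have IH: "anc j (par v) \<in> verts G" "d (anc j (par v)) = j"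
        "\<And>n. n < j \<Longrightarrow> reach (delete_verts G (B n)) (anc j (par v)) (par v)"
        using Suc.hyps(1)[of "par v"] pv j(1) by auto
      have "reach (delete_verts G (B n)) (par v) v" if "n < j" for n
        using that pv j(1) Suc by (intro reach_delete_edge) (auto simp: B_def)
      then show ?thesis using IH reach_trans unfolding j(2) by metis
    qed
  qed
  have anc_edge: "{anc j v, anc (Suc j) v} \<in> edges G" if "v \<in> verts G" "j < d v" for j v
    using that
  proof (induction "d v" arbitrary: v)
    case 0
    then show ?case by linarith
  next
    case (Suc m v)
    have "v \<noteq> v0" using Suc.hyps(2) d0(1) by auto
    then have pv: "par v \<in> verts G" "{par v, v} \<in> edges G" "d (par v) = m"
      using par[OF Suc.prems(1)] Suc.hyps(2) by auto
    show ?case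
    proof (cases "Suc j = d v")
      case True
      then show ?thesis using anc_par[OF Suc.prems] pv Suc.hyps by (simp add: anc_self)
    next
      case False
      then have "Suc j < d v" using Suc.prems(2) by simp
      moreover from this have "{anc j (par v), anc (Suc j) (par v)} \<in> edges G"
        using Suc.hyps pv(1,3) by simp
      ultimately show ?thesis
        using anc_par[OF Suc.prems] anc_par[OF Suc.prems(1), of "Suc j"] by simp
    qed
  qed
  define x where "x n = (SOME v. v \<in> X (B n))" for n
  have x: "x n \<in> X (B n)" for n
    unfolding x_def using sub[OF B] by (simp add: some_in_eq)
  have "x n \<in> verts G - B n" for n
    using x[of n] sub[OF B, of n] by (meson subsetD)
  then have xV: "x n \<in> verts G" "n < d (x n)" for n
    by (auto simp: B_def not_le)
  obtain f :: "nat \<Rightarrow> nat" where f: "strict_mono f"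
    and stab: "\<And>j. \<exists>y. \<forall>\<^sub>F k in sequentially. anc j (x (f k)) = y"
  proof (rule diagonal_stabilize[of "UNIV :: nat set" "B" "\<lambda>j k. anc j (x k)"])
    show "\<forall>\<^sub>F k in sequentially. anc j (x k) \<in> B j" for j
      using eventually_ge_at_top[of j]
    proof eventually_elim
      case (elim k)
      then have "j \<le> d (x k)" using xV(2)[of k] by simp
      then show ?case using anc[OF xV(1)] by (auto simp: B_def)
    qed
  qed (use B in auto)
  obtain r where r: "\<And>j. \<forall>\<^sub>F k in sequentially. anc j (x (f k)) = r j"
    using stab by metis
  have witness: "\<exists>k\<ge>n. anc j (x k) = r j \<and> anc (Suc j) (x k) = r (Suc j)" for j n
  proof -
    have "\<forall>\<^sub>F k in sequentially. anc j (x (f k)) = r j \<and> anc (Suc j) (x (f k)) = r (Suc j) \<and> n \<le> k"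
      by (intro eventually_conj r eventually_ge_at_top)
    then obtain k where "anc j (x (f k)) = r j" "anc (Suc j) (x (f k)) = r (Suc j)" "n \<le> k"
      using eventually_happens by force
    moreover have "k \<le> f k" by (rule seq_suble[OF f])
    ultimately show ?thesis by (meson order_trans)
  qed
  have rV: "r j \<in> verts G" "d (r j) = j" "{r j, r (Suc j)} \<in> edges G" for j
  proof -
    obtain k where "k \<ge> j" "anc j (x k) = r j" "anc (Suc j) (x k) = r (Suc j)"
      using witness[of j j] by metis
    moreover have "j < d (x k)" using xV(2)[of k] \<open>k \<ge> j\<close> by simp
    ultimately show "r j \<in> verts G" "d (r j) = j" "{r j, r (Suc j)} \<in> edges G"
      using anc[OF xV(1), of j k] anc_edge[OF xV(1), of j k] by auto
  qed
  then have ray: "r \<in> rays G"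
    by (auto simp: rays_def intro!: inj_on_inverseI[of _ d])
  have "has_tail_in r C"
    if S: "finite S" "S \<subseteq> verts G" and C: "C \<in> graph_components (delete_verts G S)"
      and v: "v \<in> X S" "v \<in> C" for S C v
  proof -
    define n where "n = Max (insert 0 (d ` S))"
    have Sn: "S \<subseteq> B n"
      using S by (auto simp: B_def n_def intro: Max_ge)
    have "r j \<in> C" if "j \<ge> Suc n" for j
    proof -
      obtain k where k: "k \<ge> j" "anc j (x k) = r j"
        using witness[of j j] by metis
      then have "reach (delete_verts G (B n)) (r j) (x k)"
        using anc[OF xV(1), of j k] xV(2)[of k] that by auto
      then have "reach (delete_verts G S) (r j) (x k)"
        using reach_delete_mono Sn by metis
      moreover have "B n \<subseteq> B k" using k that by (auto simp: B_def)
      then have "x k \<in> X S"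
        using x[of k] anti[OF B, of S k] Sn by (meson order_trans subsetD)
      then have "reach (delete_verts G S) v (x k)"
        using conn[OF S v(1)] by simp
      ultimately show ?thesis
        using reach_component[OF C v(2)] reach_sym reach_trans by metis
    qed
    then show ?thesis unfolding has_tail_in_def by blast
  qed
  moreover have "ray_equiv G `` {r} \<in> graph_ends G" "r \<in> ray_equiv G `` {r}"
    using quotientI[OF ray] equiv_class_self[OF equiv_ray_equiv ray]
    unfolding graph_ends_def by metis+
  ultimately show ?thesis
    unfolding ends_in_def by blast
qed

text \<open>
  Membership in \<open>ends_in\<close> only asks for some ray of the end with a tail in the component. The
  equivalence of rays makes the answer independent of the ray.
\<close>

lemma ends_in_unique:
  assumes S: "finite S" "S \<subseteq> verts G"
    and C: "C \<in> graph_components (delete_verts G S)" "D \<in> graph_components (delete_verts G S)"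
    and \<omega>: "\<omega> \<in> ends_in G C" "\<omega> \<in> ends_in G D"
  shows "C = D"
proof -
  have meet: "A = B" if A: "A \<in> graph_components (delete_verts G S)" "has_tail_in r A"
    and B: "B \<in> graph_components (delete_verts G S)" "has_tail_in r B" for A B r
  proof -
    obtain m n where "\<forall>k\<ge>m. r k \<in> A" "\<forall>k\<ge>n. r k \<in> B"
      using A(2) B(2) by (auto simp: has_tail_in_def)
    then have "r (max m n) \<in> A" "r (max m n) \<in> B" by auto
    then show ?thesis using graph_components_eq A(1) B(1) by metis
  qed
  obtain r s where rs: "r \<in> \<omega>" "has_tail_in r C" "s \<in> \<omega>" "has_tail_in s D"
    and \<omega>': "\<omega> \<in> rays G // ray_equiv G"
    using \<omega> by (auto simp: ends_in_def graph_ends_def)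
  then have "(r, s) \<in> ray_equiv G"
    using quotient_eq_iff[OF equiv_ray_equiv \<omega>' \<omega>'] by blast
  then obtain E where "E \<in> graph_components (delete_verts G S)" "has_tail_in r E" "has_tail_in s E"
    using S by (auto simp: ray_equiv_def)
  then show ?thesis using meet C rs by metis
qed

section \<open>Limits of cycles\<close>

text \<open>
  Rotating the list to start at \<open>v0\<close> turns the cyclic order of a cycle into a linear one.
\<close>

lemma cycle_enumeration:
  assumes c: "graph_cycle G c" and v0: "v0 \<in> set c"
  obtains h :: "nat \<Rightarrow> 'a" and N where
    "0 < N" "inj_on h {..<N}" "h ` {..<N} = set c" "h 0 = v0"
    "\<And>i. i < N \<Longrightarrow> {h i, h (Suc i mod N)} \<in> edges G"
proof -
  define N where "N = length c"
  have N: "0 < N" using v0 by (auto simp: N_def)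
  obtain i0 where i0: "i0 < N" "c ! i0 = v0"
    using v0 unfolding N_def by (meson in_set_conv_nth)
  define h where "h i = rotate i0 c ! i" for i
  have h: "h i = c ! ((i0 + i) mod N)" if "i < N" for i
    using that by (simp add: h_def N_def nth_rotate)
  have edge: "{c ! j, c ! (Suc j mod N)} \<in> edges G" if j: "j < N" for j
  proof (cases "Suc j < N")
    case True
    then show ?thesis
      using c by (simp add: graph_cycle_def N_def successively_conv_nth)
  next
    case False
    then have "Suc j = N" using j by simp
    moreover have "last c = c ! (N - 1)" "hd c = c ! 0"
      using N by (simp_all add: N_def last_conv_nth hd_conv_nth)
    ultimately show ?thesis
      using c by (auto simp: graph_cycle_def)
  qed
  have im: "h ` {..<N} = set c"
    unfolding h_def N_def by (metis atLeast0LessThan image_set length_rotate map_nth set_rotate set_upt)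
  show ?thesis
  proof (rule that[OF N _ im])
    show "inj_on h {..<N}"
      using c im by (auto intro!: eq_card_imp_inj_on simp: graph_cycle_def N_def distinct_card)
    show "h 0 = v0" using h[OF N] i0 by simp
    show "{h i, h (Suc i mod N)} \<in> edges G" if "i < N" for i
    proof -
      have "h (Suc i mod N) = c ! (Suc ((i0 + i) mod N) mod N)"
        using N by (simp add: h mod_simps)
      then show ?thesis
        using edge[of "(i0 + i) mod N"] N h[OF that] by simp
    qed
  qed
qed

text \<open>
  The limit order \<open>lt\<close> holds where the positions on the cycles are eventually in this order along
  the diagonal subsequence. Successors converge as well because \<open>v\<close> has only finitely many
  neighbours; recording the predecessors too makes \<open>nxt\<close> surjective. The last property survives the
  passage to the limit because only finitely many comparisons are involved: one cycle \<open>c k\<close>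
  orders \<open>u\<close>, \<open>v\<close> and all of \<open>S\<close> as the limit does, and its segment from \<open>u\<close> to \<open>v\<close> avoids \<open>S\<close>.
\<close>

lemma limit_of_cycles:
  fixes G :: "'a graph" and c :: "nat \<Rightarrow> 'a list"
  assumes G: "simple_graph G" "locally_finite_graph G" "countable (verts G)"
    and cyc: "\<And>k. graph_cycle G (c k)" "\<And>k. v0 \<in> set (c k)"
    and exh: "\<And>v. v \<in> verts G \<Longrightarrow> \<forall>\<^sub>F k in sequentially. v \<in> set (c k)"
  obtains lt :: "'a \<Rightarrow> 'a \<Rightarrow> bool" and nxt :: "'a \<Rightarrow> 'a" where
    "\<And>v. \<not> lt v v"
    "\<And>u v w. lt u v \<Longrightarrow> lt v w \<Longrightarrow> lt u w"
    "\<And>v w. v \<in> verts G \<Longrightarrow> w \<in> verts G \<Longrightarrow> v \<noteq> w \<Longrightarrow> lt v w \<or> lt w v"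
    "\<And>v. v \<in> verts G \<Longrightarrow> v \<noteq> v0 \<Longrightarrow> lt v0 v"
    "\<And>v. v \<in> verts G \<Longrightarrow> {v, nxt v} \<in> edges G"
    "\<And>v. v \<in> verts G \<Longrightarrow> \<exists>u\<in>verts G. nxt u = v"
    "\<And>v w. v \<in> verts G \<Longrightarrow> w \<in> verts G \<Longrightarrow> nxt v \<noteq> v0 \<Longrightarrow> lt w (nxt v) \<longleftrightarrow> w = v \<or> lt w v"
    "\<And>v w. v \<in> verts G \<Longrightarrow> w \<in> verts G \<Longrightarrow> nxt v = v0 \<Longrightarrow> w = v \<or> lt w v"
    "\<And>S u v. finite S \<Longrightarrow> S \<subseteq> verts G \<Longrightarrow> u \<in> verts G \<Longrightarrow> v \<in> verts G \<Longrightarrow> u = v \<or> lt u v \<Longrightarrow>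
      (\<And>s. s \<in> S \<Longrightarrow> s \<noteq> u \<and> s \<noteq> v \<and> \<not> (lt u s \<and> lt s v)) \<Longrightarrow> reach (delete_verts G S) u v"
proof -
  have cV: "set (c k) \<subseteq> verts G" for k
    using cyc(1)[of k] by (simp add: graph_cycle_def)
  have "\<exists>h N. 0 < N \<and> inj_on h {..<N} \<and> h ` {..<N} = set (c k) \<and> h 0 = v0 \<and>
      (\<forall>i<N. {h i, h (Suc i mod N)} \<in> edges G)" for k
    using cycle_enumeration[OF cyc(1)[of k] cyc(2)[of k]] by metis
  then obtain h N where N: "\<And>k. 0 < N k" and inj: "\<And>k. inj_on (h k) {..<N k}"
    and im: "\<And>k. h k ` {..<N k} = set (c k)" and h0: "\<And>k. h k 0 = v0"
    and hedge: "\<And>k i. i < N k \<Longrightarrow> {h k i, h k (Suc i mod N k)} \<in> edges G"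
    by metis
  define pos where "pos k v = inv_into {..<N k} (h k) v" for k v
  define nx where "nx k v = h k (Suc (pos k v) mod N k)" for k v
  define pv where "pv k v = h k ((pos k v + (N k - 1)) mod N k)" for k v
  have pos_h: "pos k (h k i) = i" if "i < N k" for k i
    using that inj by (simp add: pos_def)
  have pos: "pos k v < N k" "h k (pos k v) = v" if "v \<in> set (c k)" for k v
    using that inv_into_into[of v "h k" "{..<N k}"] f_inv_into_f[of v "h k" "{..<N k}"]
    by (simp_all add: pos_def im)
  have nx_edge: "{v, nx k v} \<in> edges G" if "v \<in> set (c k)" for k v
    using hedge[OF pos(1)[OF that]] pos(2)[OF that] by (simp add: nx_def)
  have pv_mem: "pv k v \<in> set (c k)" for k v
    using N[of k] im[of k] by (auto simp: pv_def)
  have nx_pv: "nx k (pv k v) = v" if "v \<in> set (c k)" for k v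
  proof -
    have "Suc ((pos k v + (N k - 1)) mod N k) mod N k = (pos k v + N k) mod N k"
      using N[of k] by (simp add: mod_Suc_eq)
    then show ?thesis
      using N[of k] pos[OF that] by (simp add: nx_def pv_def pos_h)
  qed
  have pv_edge: "{v, pv k v} \<in> edges G" if "v \<in> set (c k)" for k v
    using nx_edge[OF pv_mem[of k v]] nx_pv[OF that] by (simp add: insert_commute)
  \<comment> \<open>One family carries all three kinds of data, so that a single subsequence makes all of them
    converge.\<close>
  let ?g = "\<lambda>(v, w) k. (pos k v < pos k w, nx k v, pv k v)"
  let ?nb = "\<lambda>v. {w. {v, w} \<in> edges G}"
  obtain f :: "nat \<Rightarrow> nat" where f: "strict_mono f"
    and stab: "\<And>i. i \<in> verts G \<times> verts G \<Longrightarrow> \<exists>y. \<forall>\<^sub>F k in sequentially. ?g i (f k) = y"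
  proof (rule diagonal_stabilize[of "verts G \<times> verts G" "\<lambda>(v, w). UNIV \<times> ?nb v \<times> ?nb v" ?g])
    show "\<forall>\<^sub>F k in sequentially. ?g i k \<in> (case i of (v, w) \<Rightarrow> UNIV \<times> ?nb v \<times> ?nb v)"
      if i: "i \<in> verts G \<times> verts G" for i
    proof -
      obtain v w where "i = (v, w)" "v \<in> verts G" using i by auto
      then show ?thesis
        using exh[of v] by (auto elim!: eventually_mono intro: nx_edge pv_edge)
    qed
  qed (use G in \<open>auto intro!: finite_cartesian_product finite_neighbours\<close>)
  have mem: "\<forall>\<^sub>F k in sequentially. v \<in> set (c (f k))" if "v \<in> verts G" for v
    using eventually_subseq[OF f exh[OF that]] .
  define lt where "lt v w \<longleftrightarrow> (\<forall>\<^sub>F k in sequentially. pos (f k) v < pos (f k) w)" for v w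
  have dec: "lt v w \<or> (\<forall>\<^sub>F k in sequentially. \<not> pos (f k) v < pos (f k) w)"
    if vw: "v \<in> verts G" "w \<in> verts G" for v w
  proof -
    obtain b x y where "\<forall>\<^sub>F k in sequentially. ?g (v, w) (f k) = (b, x, y)"
      using stab[of "(v, w)"] vw by auto
    then have "\<forall>\<^sub>F k in sequentially. (pos (f k) v < pos (f k) w) = b"
      by (auto elim: eventually_mono)
    then show ?thesis by (cases b) (auto simp: lt_def)
  qed
  have "\<exists>x y. \<forall>\<^sub>F k in sequentially. nx (f k) v = x \<and> pv (f k) v = y" if "v \<in> verts G" for v
  proof -
    obtain b x y where "\<forall>\<^sub>F k in sequentially. ?g (v, v) (f k) = (b, x, y)"
      using stab[of "(v, v)"] \<open>v \<in> verts G\<close> by auto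
    then have "\<forall>\<^sub>F k in sequentially. nx (f k) v = x \<and> pv (f k) v = y"
      by (auto elim: eventually_mono)
    then show ?thesis by blast
  qed
  then obtain nxt prv where np: "\<And>v. v \<in> verts G \<Longrightarrow>
      \<forall>\<^sub>F k in sequentially. nx (f k) v = nxt v \<and> pv (f k) v = prv v"
    by metis
  have ex: "\<exists>k. P k" if "\<forall>\<^sub>F k in sequentially. P k" for P :: "nat \<Rightarrow> bool"
    using eventually_happens[OF that] by simp
  have total: "lt v w \<or> lt w v" if vw: "v \<in> verts G" "w \<in> verts G" "v \<noteq> w" for v w
  proof -
    have "lt w v" if "\<forall>\<^sub>F k in sequentially. \<not> pos (f k) v < pos (f k) w"
      unfolding lt_def using that mem[OF vw(1)] mem[OF vw(2)]
    proof eventually_elim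
      case (elim k)
      then show ?case using pos(2) vw(3) by (metis linorder_neqE_nat)
    qed
    then show ?thesis using dec[OF vw(1,2)] by blast
  qed
  have nxt_edge: "{v, nxt v} \<in> edges G" "{v, prv v} \<in> edges G" if "v \<in> verts G" for v
    using ex[OF eventually_conj[OF np mem], OF that that] nx_edge pv_edge by metis+
  have nxt_pos: "\<forall>\<^sub>F k in sequentially. pos (f k) (nxt v) = Suc (pos (f k) v)"
    if "v \<in> verts G" "nxt v \<noteq> v0" for v
    using np[OF that(1)] mem[OF that(1)]
  proof eventually_elim
    case (elim k)
    have "Suc (pos (f k) v) mod N (f k) \<noteq> 0"
      using elim that(2) h0 unfolding nx_def by metis
    then have "Suc (pos (f k) v) < N (f k)"
      using pos(1)[OF elim(2)] by (metis Suc_lessI mod_self)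
    then show ?case
      using elim(1) pos_h unfolding nx_def by (metis mod_less)
  qed
  show ?thesis
  proof (rule that[of lt nxt])
    show "\<not> lt v v" for v
      using ex[of "\<lambda>k. False"] by (auto simp: lt_def)
    show trans: "lt u w" if "lt u v" "lt v w" for u v w
      using that unfolding lt_def by eventually_elim simp
    show "lt v w \<or> lt w v" if "v \<in> verts G" "w \<in> verts G" "v \<noteq> w" for v w
      using total that by blast
    show "lt v0 v" if "v \<in> verts G" "v \<noteq> v0" for v
      unfolding lt_def using mem[OF that(1)]
    proof eventually_elim
      case (elim k)
      have "pos (f k) v0 = 0" using pos_h[OF N, of "f k"] h0 by metis
      moreover have "pos (f k) v \<noteq> 0" using pos(2)[OF elim] h0 that(2) by metis
      ultimately show ?case by simp
    qed
    show "{v, nxt v} \<in> edges G" if "v \<in> verts G" for v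
      using nxt_edge that by blast
    show "\<exists>u\<in>verts G. nxt u = v" if v: "v \<in> verts G" for v
    proof
      show u: "prv v \<in> verts G"
        using nxt_edge(2)[OF v] edge_verts[OF G(1)] by blast
      have "\<forall>\<^sub>F k in sequentially. nxt (prv v) = v"
        using np[OF v] np[OF u] mem[OF v]
      proof eventually_elim
        case (elim k)
        then show ?case using nx_pv by metis
      qed
      then show "nxt (prv v) = v" by simp
    qed
    show "lt w (nxt v) \<longleftrightarrow> w = v \<or> lt w v"
      if vw: "v \<in> verts G" "w \<in> verts G" "nxt v \<noteq> v0" for v w
    proof
      assume "w = v \<or> lt w v"
      then show "lt w (nxt v)"
      proof
        assume "w = v"
        then show ?thesis
          using nxt_pos[OF vw(1,3)] unfolding lt_def by (auto elim: eventually_mono)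
      next
        assume "lt w v"
        then show ?thesis
          using nxt_pos[OF vw(1,3)] unfolding lt_def by eventually_elim simp
      qed
    next
      assume "lt w (nxt v)"
      moreover have "\<not> (lt v w \<and> lt w (nxt v))"
      proof
        assume "lt v w \<and> lt w (nxt v)"
        then have "\<forall>\<^sub>F k in sequentially. pos (f k) v < pos (f k) w"
          "\<forall>\<^sub>F k in sequentially. pos (f k) w < pos (f k) (nxt v)"
          by (simp_all add: lt_def)
        then have "\<forall>\<^sub>F k in sequentially. False"
          using nxt_pos[OF vw(1,3)] by eventually_elim simp
        then show False by simp
      qed
      ultimately show "w = v \<or> lt w v" using total vw(1,2) by blast
    qed
    show "w = v \<or> lt w v" if vw: "v \<in> verts G" "w \<in> verts G" "nxt v = v0" for v w
    proof (cases "w = v")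
      case False
      have "lt w v"
        unfolding lt_def using np[OF vw(1)] mem[OF vw(1)] mem[OF vw(2)]
      proof eventually_elim
        case (elim k)
        have "h (f k) (Suc (pos (f k) v) mod N (f k)) = h (f k) 0"
          using elim(1) vw(3) h0 by (simp add: nx_def)
        then have "Suc (pos (f k) v) mod N (f k) = 0"
          using inj_onD[OF inj] N by (metis lessThan_iff mod_less_divisor)
        then have "Suc (pos (f k) v) = N (f k)"
          using pos(1)[OF elim(2)] by (metis Suc_lessI mod_less nat.distinct(1))
        moreover have "pos (f k) w \<noteq> pos (f k) v"
          using pos(2)[OF elim(2)] pos(2)[OF elim(3)] False by metis
        ultimately show ?case using pos(1)[OF elim(3)] by simp
      qed
      then show ?thesis by blast
    qed simp
    show "reach (delete_verts G S) u v"
      if S: "finite S" "S \<subseteq> verts G" and uv: "u \<in> verts G" "v \<in> verts G" "u = v \<or> lt u v"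
        and sep: "\<And>s. s \<in> S \<Longrightarrow> s \<noteq> u \<and> s \<noteq> v \<and> \<not> (lt u s \<and> lt s v)" for S u v
    proof -
      have "\<forall>\<^sub>F k in sequentially. pos (f k) s < pos (f k) u \<or> pos (f k) v < pos (f k) s"
        if "s \<in> S" for s
      proof -
        have "lt s u \<or> lt v s"
          using sep[OF that] S(2) that uv total by blast
        then show ?thesis
          by (auto simp: lt_def elim: eventually_mono)
      qed
      then have "\<forall>\<^sub>F k in sequentially. \<forall>s\<in>S. pos (f k) s < pos (f k) u \<or> pos (f k) v < pos (f k) s"
        using S(1) by (simp add: eventually_ball_finite)
      moreover have "\<forall>\<^sub>F k in sequentially. pos (f k) u \<le> pos (f k) v"
        using uv(3) by (auto simp: lt_def elim: eventually_mono)
      ultimately have "\<forall>\<^sub>F k in sequentially. reach (delete_verts G S) u v"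
        using mem[OF uv(1)] mem[OF uv(2)]
      proof eventually_elim
        case (elim k)
        let ?k = "f k"
        have avoid: "h ?k i \<in> verts G - S" if i: "pos ?k u \<le> i" "i \<le> pos ?k v" for i
        proof -
          have "i < N ?k" using i(2) pos(1)[OF elim(4)] by simp
          then have "h ?k i \<in> verts G" "pos ?k (h ?k i) = i"
            using im[of ?k] cV pos_h by auto
          then show ?thesis using elim(1) i by force
        qed
        have "reach (delete_verts G S) u (h ?k i)" if "pos ?k u \<le> i" "i \<le> pos ?k v" for i
          using that
        proof (induction i rule: dec_induct)
          case base
          then show ?case
            using avoid[of "pos ?k u"] pos(2)[OF elim(3)] by (auto intro: reach_refl)
        next
          case (step i)
          have "Suc i mod N ?k = Suc i" "i < N ?k"
            using step.prems pos(1)[OF elim(4)] by auto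
          then have "{h ?k i, h ?k (Suc i)} \<in> edges G"
            using hedge by metis
          then have "reach (delete_verts G S) (h ?k i) (h ?k (Suc i))"
            using avoid[of i] avoid[of "Suc i"] step by (intro reach_delete_edge) auto
          then show ?case using step reach_trans by (metis Suc_leD)
        qed
        from this[OF elim(2) order_refl] show ?case
          using pos(2)[OF elim(4)] by simp
      qed
      then show ?thesis by simp
    qed
  qed
qed

section \<open>Laying the limit order out on the unit interval\<close>

text \<open>
  The unit interval with \<open>0\<close> and \<open>1\<close> identified serves as the circle. The vertex \<open>v\<close> sits at
  position \<open>L v\<close>, and \<open>[L v, R v]\<close> is the time reserved for travelling along the edge from \<open>v\<close> to
  \<open>nxt v\<close>; for the last vertex this edge leads back to \<open>v0\<close>, at time \<open>1\<close>. The intervals need not cover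
  \<open>[0, 1]\<close>; the assumption \<open>conn\<close> is what allows the curve to be extended by ends to the
  remaining times.
\<close>

locale vertex_layout =
  fixes G :: "'a graph" and v0 :: 'a and nxt :: "'a \<Rightarrow> 'a" and L R :: "'a \<Rightarrow> real"
  assumes simple: "simple_graph G" and connected: "connected_graph G"
    and locally_finite: "locally_finite_graph G"
    and v0: "v0 \<in> verts G" and L_v0: "L v0 = 0"
    and R_eq: "v \<in> verts G \<Longrightarrow> R v = (if nxt v = v0 then 1 else L (nxt v))"
    and L_nonneg: "v \<in> verts G \<Longrightarrow> 0 \<le> L v"
    and L_less_R: "v \<in> verts G \<Longrightarrow> L v < R v"
    and R_le_1: "v \<in> verts G \<Longrightarrow> R v \<le> 1"
    and disjoint: "v \<in> verts G \<Longrightarrow> w \<in> verts G \<Longrightarrow> v \<noteq> w \<Longrightarrow> R v \<le> L w \<or> R w \<le> L v"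
    and nxt_edge: "v \<in> verts G \<Longrightarrow> {v, nxt v} \<in> edges G"
    and nxt_surj: "v \<in> verts G \<Longrightarrow> \<exists>u\<in>verts G. nxt u = v"
    and conn: "finite S \<Longrightarrow> S \<subseteq> verts G \<Longrightarrow> u \<in> verts G \<Longrightarrow> v \<in> verts G \<Longrightarrow> L u \<le> L v \<Longrightarrow>
      (\<And>s. s \<in> S \<Longrightarrow> \<not> (L u \<le> L s \<and> L s \<le> L v)) \<Longrightarrow> reach (delete_verts G S) u v"

lemma geometric_weights:
  assumes "countable V" "infinite V"
  obtains a :: "'a \<Rightarrow> real" where "\<And>v. 0 < a v" "(a has_sum 1) V"
proof
  define a where "a v = (1 / 2 :: real) ^ Suc (to_nat_on V v)" for v
  show "0 < a v" for v by (simp add: a_def)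
  have "((\<lambda>n. (1 / 2 :: real) ^ Suc n) has_sum 1) UNIV"
    by (rule sums_nonneg_imp_has_sum[OF power_half_series]) simp
  then show "(a has_sum 1) V"
    using has_sum_reindex_bij_betw[OF to_nat_on_infinite[OF assms], of "\<lambda>n. (1 / 2 :: real) ^ Suc n" 1]
    by (simp add: a_def[abs_def])
qed

text \<open>
  Give the vertices positive weights with sum \<open>1\<close>, and let \<open>L v\<close> and \<open>R v\<close> be the total weight of the
  vertices before \<open>v\<close>, respectively up to \<open>v\<close>, in the limit order. Immediate successors then own
  adjacent intervals, and the last vertex has \<open>R v = 1\<close> since all weight has been used up.
\<close>

lemma vertex_layout_of_cycles:
  fixes G :: "'a graph" and c :: "nat \<Rightarrow> 'a list"
  assumes G: "simple_graph G" "connected_graph G" "locally_finite_graph G"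
    and V: "countable (verts G)" "infinite (verts G)"
    and cyc: "\<And>k. graph_cycle G (c k)" "\<And>k. v0 \<in> set (c k)"
    and exh: "\<And>v. v \<in> verts G \<Longrightarrow> \<forall>\<^sub>F k in sequentially. v \<in> set (c k)"
  shows "\<exists>nxt L R. vertex_layout G v0 nxt L R"
proof -
  let ?V = "verts G"
  obtain lt nxt where irrefl: "\<And>v. \<not> lt v v"
    and trans: "\<And>u v w. lt u v \<Longrightarrow> lt v w \<Longrightarrow> lt u w"
    and total: "\<And>v w. v \<in> ?V \<Longrightarrow> w \<in> ?V \<Longrightarrow> v \<noteq> w \<Longrightarrow> lt v w \<or> lt w v"
    and least: "\<And>v. v \<in> ?V \<Longrightarrow> v \<noteq> v0 \<Longrightarrow> lt v0 v"
    and edge: "\<And>v. v \<in> ?V \<Longrightarrow> {v, nxt v} \<in> edges G"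
    and surj: "\<And>v. v \<in> ?V \<Longrightarrow> \<exists>u\<in>?V. nxt u = v"
    and succ: "\<And>v w. v \<in> ?V \<Longrightarrow> w \<in> ?V \<Longrightarrow> nxt v \<noteq> v0 \<Longrightarrow> lt w (nxt v) \<longleftrightarrow> w = v \<or> lt w v"
    and last: "\<And>v w. v \<in> ?V \<Longrightarrow> w \<in> ?V \<Longrightarrow> nxt v = v0 \<Longrightarrow> w = v \<or> lt w v"
    and conn: "\<And>S u v. finite S \<Longrightarrow> S \<subseteq> ?V \<Longrightarrow> u \<in> ?V \<Longrightarrow> v \<in> ?V \<Longrightarrow> u = v \<or> lt u v \<Longrightarrow>
      (\<And>s. s \<in> S \<Longrightarrow> s \<noteq> u \<and> s \<noteq> v \<and> \<not> (lt u s \<and> lt s v)) \<Longrightarrow> reach (delete_verts G S) u v"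
    using limit_of_cycles[OF G(1,3) V(1) cyc exh] by blast
  obtain a :: "'a \<Rightarrow> real" where a: "\<And>v. 0 < a v" "(a has_sum 1) ?V"
    using geometric_weights[OF V] by blast
  have summable: "a summable_on A" if "A \<subseteq> ?V" for A
    using a(2) that summable_on_subset_banach has_sum_imp_summable by blast
  have mono: "infsum a A \<le> infsum a B" if "A \<subseteq> B" "B \<subseteq> ?V" for A B
    using that a(1) by (intro infsum_mono2 summable) (auto intro: less_imp_le)
  have "infsum a ?V = 1"
    using a(2) by (rule infsumI)
  define D where "D v = {w \<in> ?V. lt w v}" for v
  define L where "L v = infsum a (D v)" for v
  define R where "R v = infsum a (insert v (D v))" for v
  have D: "D v \<subseteq> ?V" "v \<notin> D v" for v
    using irrefl by (auto simp: D_def)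
  have LR: "L v < R v" for v
    using infsum_insert[OF summable[OF D(1)] D(2)] a(1)[of v] by (simp add: L_def R_def)
  have lt: "R v \<le> L w" if "lt v w" "v \<in> ?V" for v w
    unfolding L_def R_def using that trans D by (intro mono) (auto simp: D_def)
  have lt_iff: "L v < L w \<longleftrightarrow> lt v w" if "v \<in> ?V" "w \<in> ?V" for v w
    using lt[of v w] lt[of w v] LR[of v] LR[of w] total[OF that] that by fastforce
  have v0: "v0 \<in> ?V" using cyc by (auto simp: graph_cycle_def)
  have "vertex_layout G v0 nxt L R"
  proof
    have "D v0 = {}"
      using least trans irrefl by (fastforce simp: D_def)
    then show "L v0 = 0" by (simp add: L_def)
    show "R v = (if nxt v = v0 then 1 else L (nxt v))" if v: "v \<in> ?V" for v
    proof (cases "nxt v = v0")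
      case True
      then have "insert v (D v) = ?V" using last v by (auto simp: D_def)
      then show ?thesis using True \<open>infsum a ?V = 1\<close> by (simp add: R_def)
    next
      case False
      then have "D (nxt v) = insert v (D v)" using succ v by (auto simp: D_def)
      then show ?thesis using False by (simp add: L_def R_def)
    qed
    show "0 \<le> L v" for v
      unfolding L_def using a(1) by (intro infsum_nonneg) (auto intro: less_imp_le)
    show "R v \<le> 1" if "v \<in> ?V" for v
      using mono[of "insert v (D v)" ?V] D(1)[of v] that \<open>infsum a ?V = 1\<close> by (simp add: R_def)
    show "R v \<le> L w \<or> R w \<le> L v" if "v \<in> ?V" "w \<in> ?V" "v \<noteq> w" for v w
      using total[OF that] lt that by blast
    show "reach (delete_verts G S) u v"
      if "finite S" "S \<subseteq> ?V" and uv: "u \<in> ?V" "v \<in> ?V" "L u \<le> L v"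
        and sep: "\<And>s. s \<in> S \<Longrightarrow> \<not> (L u \<le> L s \<and> L s \<le> L v)" for S u v
    proof (rule conn)
      show "u = v \<or> lt u v"
        using uv total lt_iff by (metis not_le)
      show "s \<noteq> u \<and> s \<noteq> v \<and> \<not> (lt u s \<and> lt s v)" if "s \<in> S" for s
        using sep[OF that] uv(3) lt_iff uv \<open>S \<subseteq> ?V\<close> that by (metis less_imp_le order_refl subsetD)
    qed (use that in auto)
  qed (use G v0 LR edge surj in auto)
  then show ?thesis by blast
qed

section \<open>Edges as paths in the compactification\<close>

lemma edge_point_0: "edge_point u v 0 = vertex_point u"
  by (auto simp: edge_point_def vertex_point_def)

lemma edge_point_1: "u \<noteq> v \<Longrightarrow> edge_point u v 1 = vertex_point v"
  by (auto simp: edge_point_def vertex_point_def)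

lemma edge_point_swap: "u \<noteq> v \<Longrightarrow> edge_point u v t = edge_point v u (1 - t)"
  by (auto simp: edge_point_def)

lemma edge_point_eq_vertex_point:
  assumes "edge_point u v t = vertex_point w"
  shows "t = 0 \<and> w = u \<or> t = 1 \<and> w = v"
  using fun_cong[OF assms, of w] by (auto simp: edge_point_def vertex_point_def split: if_splits)

lemma edge_point_in_complex:
  "{u, v} \<in> edges G \<Longrightarrow> t \<in> {0..1} \<Longrightarrow> edge_point u v t \<in> complex_points G"
  unfolding complex_points_def by blast

text \<open>
  The second part needs \<open>u \<noteq> v\<close> for an edge \<open>uv\<close>: the function \<open>edge_point u u 1\<close> vanishes
  everywhere.
\<close>

lemma complex_points_induced_support:
  assumes G: "simple_graph G" and x: "x \<in> complex_points (induced G C)"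
  shows "\<And>w. x w \<noteq> 0 \<Longrightarrow> w \<in> C" "\<exists>w\<in>C. x w \<noteq> 0"
proof -
  from x consider v where "v \<in> C" "x = vertex_point v"
    | u v t where "u \<in> C" "v \<in> C" "u \<noteq> v" "x = edge_point u v t"
    using edge_verts[OF G] by (auto simp: complex_points_def induced_def)
  then have "(\<forall>w. x w \<noteq> 0 \<longrightarrow> w \<in> C) \<and> (\<exists>w\<in>C. x w \<noteq> 0)"
  proof cases
    case 1
    then show ?thesis by (auto simp: vertex_point_def)
  next
    case 2
    then have "x u \<noteq> 0 \<or> x v \<noteq> 0" by (auto simp: edge_point_def)
    moreover have "w \<in> C" if "x w \<noteq> 0" for w
      using that 2 by (simp add: edge_point_def split: if_splits)
    ultimately show ?thesis using 2 by metis
  qed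
  then show "\<And>w. x w \<noteq> 0 \<Longrightarrow> w \<in> C" "\<exists>w\<in>C. x w \<noteq> 0" by simp_all
qed

text \<open>
  The right-hand side adds up the barycentric coordinates of the point over \<open>C\<close>. Written in this
  way, the trace of a basic neighbourhood on an edge is open whatever the position of the edge
  relative to \<open>C\<close>: it is the whole edge, an initial or final part of length \<open>\<epsilon>\<close>, or empty. An edge
  that leaves \<open>C\<close> ends in \<open>S\<close>, because \<open>C\<close> is a component of \<open>G - S\<close>.
\<close>

lemma edge_point_in_end_nbhd_iff:
  assumes G: "simple_graph G" and C: "C \<in> graph_components (delete_verts G S)"
    and uv: "{u, v} \<in> edges G" and t: "t \<in> {0..1}" and \<epsilon>: "0 < \<epsilon>" "\<epsilon> \<le> 1"
  shows "Pt (edge_point u v t) \<in> end_nbhd G S C \<epsilon> \<longleftrightarrow>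
    1 - \<epsilon> < (if u \<in> C then 1 - t else 0) + (if v \<in> C then t else 0)"
proof -
  have CV: "C \<subseteq> verts G - S"
    using component_verts[OF C] by simp
  have in_nbhd: "Pt x \<in> end_nbhd G S C \<epsilon> \<longleftrightarrow> x \<in> complex_points (induced G C) \<or>
      (\<exists>v u t. x = edge_point v u t \<and> v \<in> C \<and> u \<in> S \<and> {v, u} \<in> edges G \<and> 0 < t \<and> t < \<epsilon>)" for x
    by (auto simp: end_nbhd_def)
  have half: "Pt (edge_point u v t) \<in> end_nbhd G S C \<epsilon> \<longleftrightarrow> t < \<epsilon>"
    if uv: "{u, v} \<in> edges G" "u \<in> C" "v \<notin> C" and t: "t \<in> {0..1}" for u v t
  proof
    have "u \<noteq> v" using that by blast
    assume "Pt (edge_point u v t) \<in> end_nbhd G S C \<epsilon>"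
    then consider "edge_point u v t \<in> complex_points (induced G C)"
      | v' u' t' where "edge_point u v t = edge_point v' u' t'" "v' \<in> C" "t' < \<epsilon>"
      unfolding in_nbhd by blast
    then show "t < \<epsilon>"
    proof cases
      case 1
      then have "edge_point u v t v = 0"
        using complex_points_induced_support(1)[OF G] uv(3) by metis
      then show ?thesis using \<epsilon> \<open>u \<noteq> v\<close> by (simp add: edge_point_def)
    next
      case 2
      then have "edge_point u v t v' = 1 - t'"
        by (simp add: edge_point_def)
      moreover have "v' \<noteq> v" using 2 uv by blast
      ultimately have "t = t'"
        using 2 \<epsilon> by (auto simp: edge_point_def split: if_splits)
      then show ?thesis using 2 by simp
    qed
  next
    assume "t < \<epsilon>"
    show "Pt (edge_point u v t) \<in> end_nbhd G S C \<epsilon>"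
    proof (cases "t = 0")
      case True
      then show ?thesis
        using uv(2) CV unfolding in_nbhd by (auto simp: edge_point_0 complex_points_def induced_def)
    next
      case False
      have "v \<in> S"
      proof (rule ccontr)
        assume "v \<notin> S"
        then have "reach (delete_verts G S) u v"
          using uv CV edge_verts[OF G uv(1)] by (intro reach_delete_edge) auto
        then show False using reach_component[OF C uv(2)] uv(3) by blast
      qed
      then show ?thesis
        using False t uv \<open>t < \<epsilon>\<close> unfolding in_nbhd
        by (intro disjI2 exI[of _ u] exI[of _ v] exI[of _ t]) auto
    qed
  qed
  have "u \<noteq> v" using edge_verts[OF G uv] by simp
  consider "u \<in> C" "v \<in> C" | "u \<in> C" "v \<notin> C" | "u \<notin> C" "v \<in> C" | "u \<notin> C" "v \<notin> C" by blast
  then show ?thesis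
  proof cases
    case 1
    then have "edge_point u v t \<in> complex_points (induced G C)"
      using uv t by (intro edge_point_in_complex) (auto simp: induced_def)
    then show ?thesis using 1 \<epsilon> unfolding in_nbhd by simp
  next
    case 2
    then show ?thesis using half[OF uv 2 t] by auto
  next
    case 3
    have "Pt (edge_point u v t) \<in> end_nbhd G S C \<epsilon> \<longleftrightarrow> 1 - t < \<epsilon>"
      unfolding edge_point_swap[OF \<open>u \<noteq> v\<close>, of t]
      using uv t by (intro half 3) (auto simp: insert_commute)
    then show ?thesis using 3 by auto
  next
    case 4
    have "edge_point u v t w = 0" if "w \<in> C" for w
      using 4 that by (auto simp: edge_point_def)
    moreover have "edge_point v' u' t' v' \<noteq> 0" if "t' < \<epsilon>" for v' u' :: 'a and t'
      using that \<epsilon> by (simp add: edge_point_def)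
    ultimately have "Pt (edge_point u v t) \<notin> end_nbhd G S C \<epsilon>"
      unfolding in_nbhd using complex_points_induced_support(2)[OF G, of "edge_point u v t" C] by metis
    then show ?thesis using 4 \<epsilon> by simp
  qed
qed

lemma continuous_map_edge:
  assumes G: "simple_graph G" and uv: "{u, v} \<in> edges G"
  shows "continuous_map (top_of_set {0..1}) (freudenthal G) (\<lambda>t. Pt (edge_point u v t))"
  unfolding freudenthal_def continuous_on_generated_topo_iff
proof (intro conjI allI impI)
  let ?e = "\<lambda>t. Pt (edge_point u v t)"
  show "openin (top_of_set {0..1}) (?e -` U \<inter> topspace (top_of_set {0..1}))"
    if basic: "U \<in> {Pt ` W | W. complex_open G W} \<union>
      {end_nbhd G S C \<epsilon> | S C \<epsilon>. finite S \<and> S \<subseteq> verts G \<and>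
         C \<in> graph_components (delete_verts G S) \<and> ends_in G C \<noteq> {} \<and> 0 < \<epsilon> \<and> \<epsilon> \<le> 1}" for U
  proof -
    from basic consider W where "U = Pt ` W" "complex_open G W"
      | S C \<epsilon> where "U = end_nbhd G S C \<epsilon>" "C \<in> graph_components (delete_verts G S)" "0 < \<epsilon>" "\<epsilon> \<le> 1"
      by (elim UnE CollectE exE conjE) metis+
    then show ?thesis
    proof cases
      case W: 1
      then have "?e -` U \<inter> topspace (top_of_set {0..1}) = {t \<in> {0..1}. edge_point u v t \<in> W}"
        by auto
      then show ?thesis using W(2) uv by (simp add: complex_open_def)
    next
      case 2
      note U = 2(1) and C = 2(2) and \<epsilon> = 2(3,4)
      let ?m = "\<lambda>t::real. (if u \<in> C then 1 - t else 0) + (if v \<in> C then t else 0)"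
      have "?e -` U \<inter> topspace (top_of_set {0..1}) = {0..1} \<inter> ?m -` {1 - \<epsilon><..}"
        using edge_point_in_end_nbhd_iff[OF G C uv _ \<epsilon>] by (auto simp: U)
      moreover have "continuous_on {0..1} ?m"
        by (intro continuous_on_add; cases "u \<in> C"; cases "v \<in> C") (simp_all add: continuous_on_diff)
      ultimately show ?thesis
        using continuous_openin_preimage_gen[of "{0..1}" ?m "{1 - \<epsilon><..}"] by simp
    qed
  qed
  have "?e ` topspace (top_of_set {0..1}) \<subseteq> topspace (freudenthal G)"
    unfolding topspace_freudenthal using edge_point_in_complex[OF uv] by auto
  then show "?e ` topspace (top_of_set {0..1}) \<subseteq> \<Union> ({Pt ` W | W. complex_open G W} \<union>
      {end_nbhd G S C \<epsilon> | S C \<epsilon>. finite S \<and> S \<subseteq> verts G \<and>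
         C \<in> graph_components (delete_verts G S) \<and> ends_in G C \<noteq> {} \<and> 0 < \<epsilon> \<and> \<epsilon> \<le> 1})"
    unfolding freudenthal_def topology_generated_by_topspace .
qed

section \<open>The curve of a layout\<close>

context vertex_layout
begin

lemma nxt_in: "v \<in> verts G \<Longrightarrow> nxt v \<in> verts G"
  and nxt_neq: "v \<in> verts G \<Longrightarrow> nxt v \<noteq> v"
  using edge_verts[OF simple nxt_edge] by metis+

lemma L_inj: "v \<in> verts G \<Longrightarrow> w \<in> verts G \<Longrightarrow> L v = L w \<Longrightarrow> v = w"
  using disjoint[of v w] L_less_R[of v] L_less_R[of w] by fastforce

lemma L_nxt: "v \<in> verts G \<Longrightarrow> R v < 1 \<Longrightarrow> L (nxt v) = R v \<and> nxt v \<noteq> v0"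
  using R_eq[of v] by (auto split: if_splits)

lemma previous:
  assumes "v \<in> verts G" "v \<noteq> v0"
  obtains u where "u \<in> verts G" "nxt u = v" "R u = L v"
  using nxt_surj[OF assms(1)] assms(2) R_eq by auto

lemma nxt_inj: "inj_on nxt (verts G)"
proof (rule inj_onI)
  fix v w assume vw: "v \<in> verts G" "w \<in> verts G" "nxt v = nxt w"
  then have "R v = R w" using R_eq by simp
  then show "v = w"
    using disjoint[of v w] L_less_R[of v] L_less_R[of w] vw by fastforce
qed

text \<open>
  The points \<open>L s\<close> with \<open>s \<in> S\<close> cut the interval into pieces; \<open>gap S t\<close> consists of the vertices
  outside \<open>S\<close> whose position lies in the same piece as \<open>t\<close>.
\<close>

definition gap :: "'a set \<Rightarrow> real \<Rightarrow> 'a set" where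
  "gap S t = {v \<in> verts G - S. \<forall>s\<in>S. L s < L v \<longleftrightarrow> L s < t}"

definition covered :: "real \<Rightarrow> bool" where
  "covered t \<longleftrightarrow> (\<exists>v\<in>verts G. L v \<le> t \<and> t \<le> R v)"

text \<open>
  The end that the gaps around an uncovered time converge to; the lemma \<open>end_at\<close> below justifies
  the choice.
\<close>

definition end_at :: "real \<Rightarrow> (nat \<Rightarrow> 'a) set" where
  "end_at t = (SOME \<omega>. \<omega> \<in> graph_ends G \<and> (\<forall>S C. finite S \<longrightarrow> S \<subseteq> verts G \<longrightarrow>
      C \<in> graph_components (delete_verts G S) \<longrightarrow> gap S t \<inter> C \<noteq> {} \<longrightarrow> \<omega> \<in> ends_in G C))"

text \<open>
  At a common endpoint of two intervals there are two choices; by \<open>edge_pos_consistent\<close> they lead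
  to the same point of the curve.
\<close>

definition covering :: "real \<Rightarrow> 'a" where
  "covering t = (SOME v. v \<in> verts G \<and> L v \<le> t \<and> t \<le> R v)"

definition edge_pos :: "'a \<Rightarrow> real \<Rightarrow> 'a \<Rightarrow> real" where
  "edge_pos v t = edge_point v (nxt v) ((t - L v) / (R v - L v))"

definition curve :: "real \<Rightarrow> 'a fpoint" where
  "curve t = (if covered t then Pt (edge_pos (covering t) t) else End (end_at t))"

text \<open>
  No element of \<open>S\<close> is positioned between two vertices of the same gap, so \<open>conn\<close> applies.
\<close>

lemma gap_connected:
  assumes S: "finite S" "S \<subseteq> verts G" and vw: "v \<in> gap S t" "w \<in> gap S t"
  shows "reach (delete_verts G S) v w"
proof -
  have *: "reach (delete_verts G S) u x" if "u \<in> gap S t" "x \<in> gap S t" "L u \<le> L x" for u x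
  proof (rule conn[OF S])
    show "u \<in> verts G" "x \<in> verts G" using that by (auto simp: gap_def)
    show "\<not> (L u \<le> L s \<and> L s \<le> L x)" if s: "s \<in> S" for s
    proof
      assume le: "L u \<le> L s \<and> L s \<le> L x"
      have "s \<noteq> x" "s \<in> verts G" using s \<open>x \<in> gap S t\<close> S by (auto simp: gap_def)
      then have "L s < L x"
        using le L_inj \<open>x \<in> verts G\<close> by fastforce
      then have "L s < L u"
        using s \<open>u \<in> gap S t\<close> \<open>x \<in> gap S t\<close> by (auto simp: gap_def)
      then show False using le by simp
    qed
  qed (use that in simp)
  show ?thesis
    using *[of v w] *[of w v] vw reach_sym by (cases "L v \<le> L w") auto
qed

text \<open>
  Let \<open>s\<close> be the last of \<open>v0\<close> and the elements of \<open>S\<close> before \<open>t\<close>. Since \<open>t\<close> is not covered, the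
  interval of \<open>s\<close> ends before \<open>t\<close>, so \<open>nxt s\<close> still comes before \<open>t\<close> but after \<open>s\<close>.
\<close>

lemma gap_nonempty:
  assumes S: "finite S" "S \<subseteq> verts G" and t: "t \<in> {0..1}" and un: "\<not> covered t"
  shows "gap S t \<noteq> {}"
proof -
  let ?A = "{s \<in> insert v0 S. L s < t}"
  have nc: "v \<in> verts G \<Longrightarrow> L v < t \<Longrightarrow> R v < t" for v
    using un by (force simp: covered_def)
  have "0 < t"
    using un t v0 L_v0 L_less_R[OF v0] by (force simp: covered_def)
  then have A: "finite ?A" "v0 \<in> ?A" using S L_v0 by auto
  then have "Max (L ` ?A) \<in> L ` ?A" by (intro Max_in) blast+
  then obtain s where sm: "Max (L ` ?A) = L s" "s \<in> ?A" by (rule imageE)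
  then have s: "s \<in> ?A" "\<And>x. x \<in> ?A \<Longrightarrow> L x \<le> L s"
    using Max_ge[OF finite_imageI[OF A(1)] imageI, of _ L] by simp_all
  have sV: "s \<in> verts G" using s(1) v0 S(2) by auto
  have Rs: "R s < t" using nc sV s(1) by auto
  then have n: "L (nxt s) = R s"
    using L_nxt[OF sV] t by auto
  have less: "L s < L (nxt s)" using n L_less_R[OF sV] by simp
  have "nxt s \<in> gap S t"
    unfolding gap_def
  proof (intro CollectI conjI ballI DiffI)
    show "nxt s \<in> verts G" by (rule nxt_in[OF sV])
    show "nxt s \<notin> S"
    proof
      assume "nxt s \<in> S"
      then have "L (nxt s) \<le> L s" using s(2)[of "nxt s"] n Rs by auto
      then show False using less by simp
    qed
    show "L x < L (nxt s) \<longleftrightarrow> L x < t" if "x \<in> S" for x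
      using s(2)[of x] that n Rs less by auto
  qed
  then show ?thesis by blast
qed

lemma end_at:
  assumes t: "t \<in> {0..1}" "\<not> covered t"
  shows "end_at t \<in> graph_ends G"
    and "finite S \<Longrightarrow> S \<subseteq> verts G \<Longrightarrow> C \<in> graph_components (delete_verts G S) \<Longrightarrow>
      gap S t \<inter> C \<noteq> {} \<Longrightarrow> end_at t \<in> ends_in G C"
proof -
  have "\<exists>\<omega>\<in>graph_ends G. \<forall>S C. finite S \<longrightarrow> S \<subseteq> verts G \<longrightarrow>
      C \<in> graph_components (delete_verts G S) \<longrightarrow> gap S t \<inter> C \<noteq> {} \<longrightarrow> \<omega> \<in> ends_in G C"
  proof (rule end_of_direction[OF simple connected locally_finite])
    show "gap S t \<noteq> {} \<and> gap S t \<subseteq> verts G - S" if "finite S" "S \<subseteq> verts G" for S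
      using gap_nonempty[OF that t] by (auto simp: gap_def)
    show "gap T t \<subseteq> gap S t" if "S \<subseteq> T" for S T
      using that by (auto simp: gap_def)
  qed (rule gap_connected)
  then have *: "end_at t \<in> graph_ends G \<and> (\<forall>S C. finite S \<longrightarrow> S \<subseteq> verts G \<longrightarrow>
      C \<in> graph_components (delete_verts G S) \<longrightarrow> gap S t \<inter> C \<noteq> {} \<longrightarrow> end_at t \<in> ends_in G C)"
    unfolding end_at_def Bex_def by (rule someI_ex)
  show "end_at t \<in> graph_ends G" by (rule conjunct1[OF *])
  show "end_at t \<in> ends_in G C"
    if "finite S" "S \<subseteq> verts G" "C \<in> graph_components (delete_verts G S)" "gap S t \<inter> C \<noteq> {}"
    using conjunct2[OF *] that by simp
qed

lemma edge_pos_L: "edge_pos v (L v) = vertex_point v"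
  by (simp add: edge_pos_def edge_point_0)

lemma edge_pos_R: "v \<in> verts G \<Longrightarrow> edge_pos v (R v) = vertex_point (nxt v)"
  using L_less_R[of v] nxt_neq[of v] by (simp add: edge_pos_def edge_point_1)

lemma edge_pos_consistent:
  assumes "v \<in> verts G" "L v \<le> t" "t \<le> R v" "w \<in> verts G" "L w \<le> t" "t \<le> R w"
  shows "edge_pos v t = edge_pos w t"
proof -
  have *: "edge_pos v t = edge_pos w t"
    if v: "v \<in> verts G" "t \<le> R v" and w: "w \<in> verts G" "L w \<le> t" and le: "R v \<le> L w" for v w
  proof -
    have t: "t = R v" "t = L w" using v w le by auto
    then have "R v < 1" using L_less_R[OF w(1)] R_le_1[OF w(1)] by simp
    then have "L (nxt v) = L w" using L_nxt[OF v(1)] t by simp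
    then have "nxt v = w" using L_inj nxt_in v(1) w(1) by blast
    then show ?thesis using edge_pos_R[OF v(1)] edge_pos_L[of w] t by simp
  qed
  show ?thesis
  proof (cases "v = w")
    case False
    then show ?thesis
      using disjoint[OF assms(1,4)] *[OF assms(1,3,4,5)] *[OF assms(4,6,1,2)] by metis
  qed simp
qed

lemma curve_edge:
  assumes "v \<in> verts G" "L v \<le> t" "t \<le> R v"
  shows "curve t = Pt (edge_pos v t)"
proof -
  have "covering t \<in> verts G \<and> L (covering t) \<le> t \<and> t \<le> R (covering t)"
    unfolding covering_def by (rule someI[of _ v]) (use assms in simp)
  moreover have "covered t" using assms by (auto simp: covered_def)
  ultimately show ?thesis
    using edge_pos_consistent[of "covering t" t v] assms by (simp add: curve_def)
qed

lemma curve_L: "v \<in> verts G \<Longrightarrow> curve (L v) = Pt (vertex_point v)"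
  using curve_edge[of v "L v"] L_less_R[of v] by (simp add: edge_pos_L)

lemma curve_closed: "curve 0 = curve 1"
proof -
  obtain u where u: "u \<in> verts G" "nxt u = v0"
    using nxt_surj[OF v0] by blast
  then have "R u = 1" using R_eq by simp
  then have "curve 1 = Pt (vertex_point v0)"
    using curve_edge[of u 1] u L_less_R[of u] edge_pos_R[of u] by simp
  then show ?thesis using curve_L[OF v0] L_v0 by simp
qed

text \<open>
  The time \<open>1\<close> is excluded because there the curve is back at \<open>v0\<close>.
\<close>

lemma curve_eq_vertex_iff:
  assumes v: "v \<in> verts G" and t: "0 \<le> t" "t < 1"
  shows "curve t = Pt (vertex_point v) \<longleftrightarrow> t = L v"
proof
  assume eq: "curve t = Pt (vertex_point v)"
  then have "covered t" by (auto simp: curve_def split: if_splits)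
  then obtain w where w: "w \<in> verts G" "L w \<le> t" "t \<le> R w"
    by (auto simp: covered_def)
  have less: "L w < R w" by (rule L_less_R[OF w(1)])
  have "edge_pos w t = vertex_point v"
    using eq curve_edge[OF w] by simp
  then consider "(t - L w) / (R w - L w) = 0" "v = w" | "(t - L w) / (R w - L w) = 1" "v = nxt w"
    unfolding edge_pos_def by (blast dest: edge_point_eq_vertex_point)
  then show "t = L v"
  proof cases
    case 1
    then show ?thesis using less by simp
  next
    case 2
    then have "t = R w" using less by (simp add: field_simps)
    then show ?thesis using L_nxt[OF w(1)] t 2 by simp
  qed
qed (use curve_L v in simp)

lemma continuous_map_curve_edge:
  assumes v: "v \<in> verts G"
  shows "continuous_map (top_of_set {L v..R v}) (freudenthal G) curve"
proof -
  let ?p = "\<lambda>t. (t - L v) / (R v - L v)"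
  have "continuous_on {L v..R v} ?p"
    using L_less_R[OF v] by (intro continuous_intros) auto
  then have "continuous_map (top_of_set {L v..R v}) (top_of_set {0..1}) ?p"
    using L_less_R[OF v] by (auto simp: divide_simps)
  then have "continuous_map (top_of_set {L v..R v}) (freudenthal G)
      ((\<lambda>s. Pt (edge_point v (nxt v) s)) \<circ> ?p)"
    using continuous_map_compose continuous_map_edge[OF simple nxt_edge[OF v]] by blast
  then show ?thesis
    by (rule continuous_map_eq) (use curve_edge[OF v] in \<open>auto simp: edge_pos_def\<close>)
qed

lemma curve_near_in_edge:
  assumes v: "v \<in> verts G" and t: "L v \<le> t" "t \<le> R v"
    and U: "openin (freudenthal G) U" "curve t \<in> U"
  shows "\<exists>\<delta>>0. \<forall>t'. L v \<le> t' \<and> t' \<le> R v \<and> \<bar>t' - t\<bar> < \<delta> \<longrightarrow> curve t' \<in> U"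
proof -
  have "openin (top_of_set {L v..R v}) {x \<in> {L v..R v}. curve x \<in> U}"
    using openin_continuous_map_preimage[OF continuous_map_curve_edge[OF v] U(1)] by simp
  moreover have "t \<in> {x \<in> {L v..R v}. curve x \<in> U}" using t U(2) by simp
  ultimately obtain \<delta> where "\<delta> > 0"
    "\<And>t'. t' \<in> {L v..R v} \<Longrightarrow> dist t' t < \<delta> \<Longrightarrow> t' \<in> {x \<in> {L v..R v}. curve x \<in> U}"
    unfolding openin_euclidean_subtopology_iff by meson
  then show ?thesis by (auto simp: dist_real_def)
qed

text \<open>
  On both sides of \<open>t\<close> the curve runs along an edge for a while: at an endpoint of an interval the
  adjacent interval belongs to the next or to the previous vertex. Only at \<open>0\<close> and \<open>1\<close> one of the
  sides is missing.
\<close>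

lemma curve_near_covered:
  assumes t: "t \<in> {0..1}" "covered t" and U: "openin (freudenthal G) U" "curve t \<in> U"
  shows "\<exists>\<delta>>0. \<forall>t'\<in>{0..1}. \<bar>t' - t\<bar> < \<delta> \<longrightarrow> curve t' \<in> U"
proof -
  obtain v where v: "v \<in> verts G" "L v \<le> t" "t \<le> R v"
    using t(2) by (auto simp: covered_def)
  have left: "\<exists>\<delta>>0. \<forall>t'\<in>{0..t}. t - t' < \<delta> \<longrightarrow> curve t' \<in> U"
  proof (cases "t = 0")
    case False
    have "\<exists>w\<in>verts G. L w < t \<and> t \<le> R w"
    proof (cases "L v < t")
      case False
      then have "t = L v" using v by simp
      then obtain u where "u \<in> verts G" "R u = t"
        using \<open>t \<noteq> 0\<close> previous[OF v(1)] L_v0 by metis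
      then show ?thesis using L_less_R[of u] by auto
    qed (use v in auto)
    then obtain w where w: "w \<in> verts G" "L w < t" "t \<le> R w" by blast
    then obtain \<delta> where "\<delta> > 0" "\<And>t'. L w \<le> t' \<Longrightarrow> t' \<le> R w \<Longrightarrow> \<bar>t' - t\<bar> < \<delta> \<Longrightarrow> curve t' \<in> U"
      using curve_near_in_edge[OF w(1) _ w(3) U] by force
    then show ?thesis using w by (intro exI[of _ "min \<delta> (t - L w)"]) auto
  qed (use U(2) in \<open>auto intro!: exI[of _ 1]\<close>)
  have right: "\<exists>\<delta>>0. \<forall>t'\<in>{t..1}. t' - t < \<delta> \<longrightarrow> curve t' \<in> U"
  proof (cases "t = 1")
    case False
    have "\<exists>w\<in>verts G. L w \<le> t \<and> t < R w"
    proof (cases "t < R v")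
      case False
      then have "t = R v" using v by simp
      then have "L (nxt v) = t" using L_nxt[OF v(1)] \<open>t \<noteq> 1\<close> t(1) by auto
      then show ?thesis using L_less_R[OF nxt_in[OF v(1)]] nxt_in[OF v(1)] by auto
    qed (use v in auto)
    then obtain w where w: "w \<in> verts G" "L w \<le> t" "t < R w" by blast
    then obtain \<delta> where "\<delta> > 0" "\<And>t'. L w \<le> t' \<Longrightarrow> t' \<le> R w \<Longrightarrow> \<bar>t' - t\<bar> < \<delta> \<Longrightarrow> curve t' \<in> U"
      using curve_near_in_edge[OF w(1,2) _ U] by force
    then show ?thesis using w by (intro exI[of _ "min \<delta> (R w - t)"]) auto
  qed (use U(2) in \<open>auto intro!: exI[of _ 1]\<close>)
  obtain \<delta>1 \<delta>2 where "\<delta>1 > 0" "\<forall>t'\<in>{0..t}. t - t' < \<delta>1 \<longrightarrow> curve t' \<in> U"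
    "\<delta>2 > 0" "\<forall>t'\<in>{t..1}. t' - t < \<delta>2 \<longrightarrow> curve t' \<in> U"
    using left right by blast
  then have "curve t' \<in> U" if "t' \<in> {0..1}" "\<bar>t' - t\<bar> < min \<delta>1 \<delta>2" for t'
    using that by (cases "t' \<le> t") auto
  then show ?thesis
    using \<open>\<delta>1 > 0\<close> \<open>\<delta>2 > 0\<close> by (intro exI[of _ "min \<delta>1 \<delta>2"]) auto
qed

text \<open>
  The end at \<open>t\<close> lives in \<open>C\<close>, so the vertices of \<open>gap S t\<close> belong to \<open>C\<close>. Times close to \<open>t\<close> have the
  same gap as \<open>t\<close>: if uncovered, they are sent to an end of \<open>C\<close> as well, and if covered by \<open>v\<close>, then
  \<open>v \<in> C\<close>. To keep the whole edge from \<open>v\<close> to \<open>nxt v\<close> inside \<open>C\<close>, the neighbourhood of \<open>t\<close> also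
  avoids the finitely many intervals of vertices whose successor is in \<open>S\<close>.
\<close>

lemma curve_near_uncovered:
  assumes t: "t \<in> {0..1}" "\<not> covered t"
    and S: "finite S" "S \<subseteq> verts G" and C: "C \<in> graph_components (delete_verts G S)"
    and \<epsilon>: "0 < \<epsilon>" "\<epsilon> \<le> 1" and inC: "curve t \<in> end_nbhd G S C \<epsilon>"
  shows "\<exists>\<delta>>0. \<forall>t'\<in>{0..1}. \<bar>t' - t\<bar> < \<delta> \<longrightarrow> curve t' \<in> end_nbhd G S C \<epsilon>"
proof -
  have endC: "end_at t \<in> ends_in G C"
    using inC t(2) by (auto simp: curve_def end_nbhd_def)
  obtain x where x: "x \<in> gap S t"
    using gap_nonempty[OF S t] by blast
  let ?D = "{v. reach (delete_verts G S) x v}"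
  have D: "?D \<in> graph_components (delete_verts G S)"
    using x by (intro component_of) (auto simp: gap_def)
  have xD: "x \<in> ?D" using gap_connected[OF S x x] by simp
  have "end_at t \<in> ends_in G ?D"
    using end_at(2)[OF t S D] x xD by blast
  then have "C = ?D" using ends_in_unique[OF S C D endC] by blast
  then have xC: "x \<in> C" using xD by blast
  have gapC: "gap S t \<subseteq> C"
    using gap_connected[OF S x] reach_component[OF C xC] by blast
  let ?T = "S \<union> {v \<in> verts G. nxt v \<in> S}"
  have T: "finite ?T" "?T \<subseteq> verts G"
    using S finite_vimage_IntI[OF S(1) nxt_inj] by (auto simp: vimage_def Int_def conj_commute)
  have "\<forall>\<^sub>F t' in nhds t. (L s < t' \<longleftrightarrow> L s < t) \<and> \<not> (L s \<le> t' \<and> t' \<le> R s)" if "s \<in> ?T" for s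
  proof -
    have "s \<in> verts G" using that T by blast
    then consider "t < L s" | "R s < t" "L s < t"
      using t(2) L_less_R[of s] by (force simp: covered_def)
    then show ?thesis
    proof cases
      case 1
      then have "\<forall>\<^sub>F t' in nhds t. t' \<in> {..<L s}"
        by (intro eventually_nhds_in_open) auto
      then show ?thesis by eventually_elim (use 1 in auto)
    next
      case 2
      then have "\<forall>\<^sub>F t' in nhds t. t' \<in> {R s<..}"
        by (intro eventually_nhds_in_open) auto
      then show ?thesis by eventually_elim (use 2 L_less_R[OF \<open>s \<in> verts G\<close>] in auto)
    qed
  qed
  then have "\<forall>\<^sub>F t' in nhds t. \<forall>s\<in>?T. (L s < t' \<longleftrightarrow> L s < t) \<and> \<not> (L s \<le> t' \<and> t' \<le> R s)"
    using T(1) by (intro eventually_ball_finite) auto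
  then obtain \<delta> where \<delta>: "\<delta> > 0" and near: "\<And>t' s. \<bar>t' - t\<bar> < \<delta> \<Longrightarrow> s \<in> ?T \<Longrightarrow>
      (L s < t' \<longleftrightarrow> L s < t) \<and> \<not> (L s \<le> t' \<and> t' \<le> R s)"
    unfolding eventually_nhds_metric dist_real_def by metis
  have "curve t' \<in> end_nbhd G S C \<epsilon>" if t': "t' \<in> {0..1}" "\<bar>t' - t\<bar> < \<delta>" for t'
  proof (cases "covered t'")
    case True
    then obtain v where v: "v \<in> verts G" "L v \<le> t'" "t' \<le> R v"
      by (auto simp: covered_def)
    then have "v \<notin> ?T" using near[OF t'(2), of v] by blast
    then have vS: "v \<notin> S" "nxt v \<notin> S" using v by auto
    have "L s < L v \<longleftrightarrow> L s < t" if s: "s \<in> S" for s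
    proof -
      have sV: "s \<in> verts G" "s \<noteq> v" using s S vS by auto
      have "L s < L v \<longleftrightarrow> L s < t'"
        using disjoint[OF sV(1) v(1) sV(2)] near[OF t'(2), of s] s v L_less_R[OF sV(1)] by auto
      then show ?thesis using near[OF t'(2), of s] s by auto
    qed
    then have vC: "v \<in> C" using gapC v(1) vS(1) by (auto simp: gap_def)
    have "reach (delete_verts G S) v (nxt v)"
      using nxt_edge v vS nxt_in by (intro reach_delete_edge) auto
    then have nC: "nxt v \<in> C" using reach_component[OF C vC] by blast
    have "(t' - L v) / (R v - L v) \<in> {0..1}"
      using v L_less_R[OF v(1)] by (auto simp: divide_simps)
    then have "Pt (edge_pos v t') \<in> end_nbhd G S C \<epsilon>"
      using edge_point_in_end_nbhd_iff[OF simple C nxt_edge[OF v(1)] _ \<epsilon>] vC nC \<epsilon>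
      by (simp add: edge_pos_def)
    then show ?thesis using curve_edge[OF v] by simp
  next
    case False
    have "gap S t' = gap S t"
      using near[OF t'(2)] by (auto simp: gap_def)
    then have "end_at t' \<in> ends_in G C"
      using end_at(2)[OF t'(1) False S C] x xC by blast
    then show ?thesis using False by (simp add: curve_def end_nbhd_def)
  qed
  then show ?thesis using \<delta> by blast
qed

lemma continuous_map_curve: "continuous_map (top_of_set {0..1}) (freudenthal G) curve"
  unfolding freudenthal_def continuous_on_generated_topo_iff
proof (intro conjI allI impI)
  let ?basis = "{Pt ` W | W. complex_open G W} \<union>
      {end_nbhd G S C \<epsilon> | S C \<epsilon>. finite S \<and> S \<subseteq> verts G \<and>
         C \<in> graph_components (delete_verts G S) \<and> ends_in G C \<noteq> {} \<and> 0 < \<epsilon> \<and> \<epsilon> \<le> 1}"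
  show "openin (top_of_set {0..1}) (curve -` U \<inter> topspace (top_of_set {0..1}))"
    if U: "U \<in> ?basis" for U
  proof -
    have "\<exists>\<delta>>0. \<forall>t'\<in>{0..1}. \<bar>t' - t\<bar> < \<delta> \<longrightarrow> curve t' \<in> U" if t: "t \<in> {0..1}" "curve t \<in> U" for t
    proof (cases "covered t")
      case True
      have "openin (freudenthal G) U"
        unfolding freudenthal_def by (rule topology_generated_by_Basis[OF U])
      then show ?thesis using curve_near_covered True t by blast
    next
      case False
      from U consider W where "U = Pt ` W"
        | S C \<epsilon> where "U = end_nbhd G S C \<epsilon>" "finite S" "S \<subseteq> verts G"
          "C \<in> graph_components (delete_verts G S)" "0 < \<epsilon>" "\<epsilon> \<le> 1"
        by (elim UnE CollectE exE conjE) metis+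
      then show ?thesis
      proof cases
        case 1
        then show ?thesis using t(2) False by (auto simp: curve_def)
      next
        case 2
        then show ?thesis using curve_near_uncovered[OF t(1) False] t(2) by simp
      qed
    qed
    then show ?thesis
      unfolding openin_euclidean_subtopology_iff by (auto simp: dist_real_def)
  qed
  have "curve t \<in> topspace (freudenthal G)" if t: "t \<in> {0..1}" for t
  proof (cases "covered t")
    case True
    then obtain v where v: "v \<in> verts G" "L v \<le> t" "t \<le> R v"
      by (auto simp: covered_def)
    then show ?thesis
      using continuous_map_image_subset_topspace[OF continuous_map_curve_edge[OF v(1)]] by auto
  next
    case False
    then show ?thesis
      using end_at(1)[OF t False] by (simp add: curve_def topspace_freudenthal)
  qed
  then have "curve ` topspace (top_of_set {0..1}) \<subseteq> topspace (freudenthal G)" by auto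
  then show "curve ` topspace (top_of_set {0..1}) \<subseteq> \<Union> ?basis"
    unfolding freudenthal_def topology_generated_by_topspace .
qed

text \<open>
  The interval maps onto the circle by a quotient map that identifies exactly \<open>0\<close> and \<open>1\<close>, where
  the curve takes the same value, so the curve descends to the circle.
\<close>

lemma hamiltonian_curve_exists: "\<exists>K. hamiltonian_curve G K"
proof -
  define p :: "real \<Rightarrow> complex" where "p t = cis (2 * pi * t)" for t
  define \<gamma> where "\<gamma> z = curve (Arg2pi z / (2 * pi))" for z
  let ?I = "top_of_set {0..1::real}" and ?S = "top_of_set (sphere (0::complex) 1)"
  have p_arg: "p (Arg2pi z / (2 * pi)) = z" if "z \<in> sphere 0 1" for z
    using Arg2pi_eq[of z] that by (simp add: p_def cis_conv_exp)
  have arg_p: "Arg2pi (p t) / (2 * pi) = t" if "0 \<le> t" "t < 1" for t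
  proof -
    have "Arg2pi (p t) = 2 * pi * t"
      using that by (intro Arg2pi_unique[of 1]) (auto simp: p_def cis_conv_exp)
    then show ?thesis by simp
  qed
  have arg: "0 \<le> Arg2pi z / (2 * pi)" "Arg2pi z / (2 * pi) < 1" for z
    using Arg2pi[of z] by auto
  have sphere: "p t \<in> sphere 0 1" for t
    by (simp add: p_def)
  have "continuous_on {0..1} p"
    unfolding p_def by (intro continuous_intros)
  then have "continuous_map ?I ?S p"
    using sphere by auto
  moreover have "z \<in> p ` {0..1}" if "z \<in> sphere 0 1" for z
    using p_arg[OF that] arg[of z] by (intro image_eqI[of _ _ "Arg2pi z / (2 * pi)"]) auto
  then have "p ` topspace ?I = topspace ?S"
    using sphere by auto
  ultimately have quot: "quotient_map ?I ?S p"
    by (intro continuous_imp_quotient_map)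
      (simp_all add: compact_space_subtopology Hausdorff_space_subtopology)
  have \<gamma>_p: "(\<gamma> \<circ> p) t = curve t" if "t \<in> {0..1}" for t
  proof (cases "t = 1")
    case True
    have "p 1 = p 0" by (simp add: p_def)
    then show ?thesis using True arg_p[of 0] curve_closed by (simp add: \<gamma>_def)
  next
    case False
    then show ?thesis using that arg_p by (simp add: \<gamma>_def)
  qed
  have "continuous_map ?I (freudenthal G) (\<gamma> \<circ> p)"
    by (rule continuous_map_eq[OF continuous_map_curve]) (use \<gamma>_p in auto)
  then have cont: "continuous_map ?S (freudenthal G) \<gamma>"
    by (rule continuous_compose_quotient_map[OF quot])
  have "\<exists>!z. z \<in> sphere 0 1 \<and> \<gamma> z = Pt (vertex_point v)" if v: "v \<in> verts G" for v
  proof (rule ex1I[of _ "p (L v)"])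
    have "0 \<le> L v" "L v < 1"
      using L_nonneg[OF v] L_less_R[OF v] R_le_1[OF v] by auto
    then show "p (L v) \<in> sphere 0 1 \<and> \<gamma> (p (L v)) = Pt (vertex_point v)"
      using sphere arg_p curve_L[OF v] by (simp add: \<gamma>_def)
    show "z = p (L v)" if "z \<in> sphere 0 1 \<and> \<gamma> z = Pt (vertex_point v)" for z
      using that p_arg[of z] curve_eq_vertex_iff[OF v arg, of z] by (simp add: \<gamma>_def)
  qed
  then have "hamiltonian_curve G (\<gamma> ` sphere 0 1)"
    unfolding hamiltonian_curve_def using cont by blast
  then show ?thesis by blast
qed

end

section \<open>Hamiltonian curves from finite cycles\<close>

lemma graph_cycle_induced: "graph_cycle (induced G W) c \<Longrightarrow> graph_cycle G c"
  using successively_mono[of "\<lambda>x y. {x, y} \<in> edges (induced G W)" c "\<lambda>x y. {x, y} \<in> edges G"]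
  by (auto simp: graph_cycle_def induced_def)

text \<open>
  Cycles through larger and larger balls around \<open>v0\<close> eventually contain every vertex; since the
  balls are finite, they also show that the graph is countable.
\<close>

theorem hamiltonian_curve_of_cycles:
  fixes G :: "'a graph"
  assumes G: "simple_graph G" "connected_graph G" "locally_finite_graph G" "infinite (verts G)"
    and cycles: "\<And>S. finite S \<Longrightarrow> S \<subseteq> verts G \<Longrightarrow> \<exists>c. graph_cycle G c \<and> S \<subseteq> set c"
  shows "\<exists>K. hamiltonian_curve G K"
proof -
  obtain v0 where v0: "v0 \<in> verts G"
    using G(2) by (auto simp: connected_graph_def)
  obtain d :: "'a \<Rightarrow> nat" where d: "\<And>n. finite {v \<in> verts G. d v \<le> n}"
    using level_function[OF G(1-3) v0] by metis
  let ?B = "\<lambda>n. {v \<in> verts G. d v \<le> n}"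
  have "verts G = (\<Union>n. ?B n)" by auto
  moreover have "countable (\<Union>n. ?B n)"
    by (rule countable_UN) (simp_all add: countable_finite d)
  ultimately have count: "countable (verts G)" by simp
  have "\<exists>c. graph_cycle G c \<and> insert v0 (?B n) \<subseteq> set c" for n
    using d v0 by (intro cycles) auto
  then obtain c where c: "\<And>n. graph_cycle G (c n)" "\<And>n. insert v0 (?B n) \<subseteq> set (c n)"
    by metis
  have "\<exists>nxt L R. vertex_layout G v0 nxt L R"
  proof (rule vertex_layout_of_cycles[OF G(1-3) count G(4) c(1)])
    show "v0 \<in> set (c n)" for n using c(2) by blast
    show "\<forall>\<^sub>F n in sequentially. v \<in> set (c n)" if v: "v \<in> verts G" for v
      using eventually_ge_at_top[of "d v"] by eventually_elim (use c(2) v in auto)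
  qed
  then obtain nxt L R where "vertex_layout G v0 nxt L R" by blast
  then show ?thesis by (rule vertex_layout.hamiltonian_curve_exists)
qed

theorem proposition3p4:
  fixes G :: "'a graph"
  assumes "simple_graph G"
    and "connected_graph G"
    and "locally_finite_graph G"
    and "infinite (verts G)"
    and "\<And>u r. u \<in> verts G \<Longrightarrow> r \<ge> 1 \<Longrightarrow> hamiltonian (graph_ball G u r)"
  shows "\<exists>K. hamiltonian_curve G K"
proof (rule hamiltonian_curve_of_cycles[OF assms(1-4)])
  fix S assume S: "finite S" "S \<subseteq> verts G"
  obtain u where u: "u \<in> verts G"
    using assms(2) by (auto simp: connected_graph_def)
  have "\<exists>n. graph_dist G u v \<le> enat n" if "v \<in> verts G" for v
    using assms(2) u that unfolding connected_graph_def graph_dist_le_iff by (meson le_SucI order_refl)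
  then obtain d :: "'a \<Rightarrow> nat" where d: "\<And>v. v \<in> verts G \<Longrightarrow> graph_dist G u v \<le> enat (d v)"
    by metis
  define r where "r = Max (insert 1 (d ` S))"
  have r: "r \<ge> 1" "\<And>v. v \<in> S \<Longrightarrow> d v \<le> r"
    using S(1) by (auto simp: r_def)
  have "graph_dist G u v \<le> enat r" if v: "v \<in> S" for v
  proof -
    have "graph_dist G u v \<le> enat (d v)" using d S(2) v by blast
    also have "\<dots> \<le> enat r" using r(2)[OF v] by simp
    finally show ?thesis .
  qed
  then have "S \<subseteq> ball_verts G u r"
    using S(2) by (auto simp: ball_verts_def)
  moreover obtain c where c: "graph_cycle (graph_ball G u r) c" "set c = verts (graph_ball G u r)"
    using assms(5)[OF u r(1)] by (auto simp: hamiltonian_def)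
  ultimately have "S \<subseteq> set c"
    using S(2) by (auto simp: graph_ball_def induced_def)
  then show "\<exists>c. graph_cycle G c \<and> S \<subseteq> set c"
    using c(1) graph_cycle_induced unfolding graph_ball_def by blast
qed

end
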